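(* \textsc{Egalitarian Stable Roommates} without ties admits a problem kernel of size $O(\gamma^2)$ with at most $2\gamma+1$ agents and at most $\gamma+1$ agents in each preference list; that is, there is a polynomial-time algorithm that maps each instance $(\mathcal{P},\gamma)$ whose preferences have no ties to an equivalent instance (a yes-instance iff the input is) of \textsc{Egalitarian Stable Roommates} without ties that has size $O(\gamma^2)$, at most $2\gamma+1$ agents, and preference lists of length at most $\gamma+1$.
   Context: Agents $V=\{1,\dots,n\}$ ($n$ even); each agent $i$ has an acceptable set $V_i\subseteq V\setminus\{i\}$ with a preference list $\succeq_i$ on $V_i$; "without ties" means each list is a strict linear order (lists may be incomplete). Acceptability graph: edge $\{x,y\}$ iff $x\in V_y$, $y\in V_x$. A matching is a set of disjoint edges; $M(x)$ is $x$'s partner or $\bot$. An edge $\{x,y\}\notin M$ blocks $M$ if ($M(x)=\bot$ or $y\succ_x M(x)$) and ($M(y)=\bot$ or $x\succ_y M(y)$); stable means no blocking pair. $\mathrm{rank}_j(i)=|\{x:x\succ_j i\}|$, $\mathrm{rank}_i(\bot)=|V_i|$, egalitarian cost $\gamma(M)=\sum_i\mathrm{rank}_i(M(i))$. \textsc{Egalitarian Stable Roommates}: given a profile and $\gamma\in\mathbb{N}$, is there a stable matching with egalitarian cost at most $\gamma$?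
   Formalization: The bound of 2γ+1 agents is claimed only for γ > 0: for γ = 0 it would force the empty instance (n is even), always a yes-instance, whereas no-instances with γ = 0 exist (two agents, agent 1 lists 2, agent 2 lists nobody). *)

theory Defs
  imports "HOL-Library.Landau_Symbols" "HOL-Computational_Algebra.Polynomial"
begin

section \<open>Preference profiles and stable matchings\<close>

text \<open>
  A profile without ties on the agents \<open>1, \<dots>, n\<close> is the list of the \<open>n\<close> preference lists: the entry
  at index \<open>i - 1\<close> enumerates \<open>V\<^sub>i\<close> from the most to the least preferred agent, so a strict linear
  order on \<open>V\<^sub>i\<close> is the same thing as a duplicate-free list.  Acceptability need not be mutual;
  a non-mutual entry gives no edge, but it still counts in the ranks.
\<close>

type_synonym profile = "nat list list"

definition agents :: "profile \<Rightarrow> nat set" where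
  "agents P = {1..length P}"

definition pref_list :: "profile \<Rightarrow> nat \<Rightarrow> nat list" where
  "pref_list P i = P ! (i - 1)"

definition acceptable :: "profile \<Rightarrow> nat \<Rightarrow> nat set" where
  "acceptable P i = set (pref_list P i)"

definition prefers :: "profile \<Rightarrow> nat \<Rightarrow> nat \<Rightarrow> nat \<Rightarrow> bool" where
  "prefers P i x y \<longleftrightarrow>
     (\<exists>k l. k < l \<and> l < length (pref_list P i) \<and> pref_list P i ! k = x \<and> pref_list P i ! l = y)"

definition wf_profile :: "profile \<Rightarrow> bool" where
  "wf_profile P \<longleftrightarrow> even (length P) \<and>
     (\<forall>i\<in>agents P. distinct (pref_list P i) \<and> acceptable P i \<subseteq> agents P - {i})"

definition edges :: "profile \<Rightarrow> nat set set" where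
  "edges P = {{x, y} |x y. x \<in> agents P \<and> y \<in> agents P \<and> x \<in> acceptable P y \<and> y \<in> acceptable P x}"

definition matching :: "profile \<Rightarrow> nat set set \<Rightarrow> bool" where
  "matching P M \<longleftrightarrow> M \<subseteq> edges P \<and> pairwise disjnt M"

text \<open>The value \<^const>\<open>None\<close> stands for \<open>\<bottom>\<close>, that is, for being unmatched.\<close>

definition partner :: "nat set set \<Rightarrow> nat \<Rightarrow> nat option" where
  "partner M x = (if \<exists>y. {x, y} \<in> M then Some (THE y. {x, y} \<in> M) else None)"

definition would_switch :: "profile \<Rightarrow> nat set set \<Rightarrow> nat \<Rightarrow> nat \<Rightarrow> bool" where
  "would_switch P M x y \<longleftrightarrow>
     (case partner M x of None \<Rightarrow> True | Some z \<Rightarrow> prefers P x y z)"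

definition blocking :: "profile \<Rightarrow> nat set set \<Rightarrow> nat \<Rightarrow> nat \<Rightarrow> bool" where
  "blocking P M x y \<longleftrightarrow>
     {x, y} \<in> edges P - M \<and> would_switch P M x y \<and> would_switch P M y x"

definition stable :: "profile \<Rightarrow> nat set set \<Rightarrow> bool" where
  "stable P M \<longleftrightarrow> matching P M \<and> \<not> (\<exists>x y. blocking P M x y)"

fun rank :: "profile \<Rightarrow> nat \<Rightarrow> nat option \<Rightarrow> nat" where
  "rank P j (Some i) = card {x \<in> acceptable P j. prefers P j x i}"
| "rank P j None = card (acceptable P j)"

definition egal_cost :: "profile \<Rightarrow> nat set set \<Rightarrow> nat" where
  "egal_cost P M = (\<Sum>i\<in>agents P. rank P i (partner M i))"


section \<open>The decision problem\<close>

type_synonym esr_instance = "profile \<times> nat"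

definition esr_instances :: "esr_instance set" where
  "esr_instances = {(P, \<gamma>). wf_profile P}"

definition esr_yes :: "esr_instance \<Rightarrow> bool" where
  "esr_yes = (\<lambda>(P, \<gamma>). \<exists>M. stable P M \<and> egal_cost P M \<le> \<gamma>)"

text \<open>
  The size used to measure kernels: agents plus entries of the preference lists, plus the parameter
  itself, so that a bound on the size also bounds the parameter.
\<close>

definition esr_size :: "esr_instance \<Rightarrow> nat" where
  "esr_size = (\<lambda>(P, \<gamma>). length P + sum_list (map length P) + \<gamma>)"

text \<open>
  An instance with at most one agent is a yes-instance, while there are no-instances with cost
  bound \<open>0\<close>.  Hence an equivalent instance with at most \<open>2\<gamma> + 1\<close> agents can only be
  asked for if \<open>\<gamma> > 0\<close>.
\<close>

lemma esr_yes_if_at_most_one_agent: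
  assumes "wf_profile P" and "length P \<le> 1"
  shows "esr_yes (P, \<gamma>)"
proof -
  have P: "P = []"
    using assms by (cases P) (auto simp: wf_profile_def)
  have "stable P {}" and "egal_cost P {} = 0"
    by (auto simp: P stable_def matching_def blocking_def edges_def egal_cost_def agents_def)
  then show ?thesis
    by (auto simp: esr_yes_def)
qed

lemma esr_no_zero:
  "([[2], []], 0) \<in> esr_instances" "\<not> esr_yes ([[2], []], 0)"
proof -
  let ?P = "[[2], []] :: profile"
  have ag: "agents ?P = {1, 2}"
    by (auto simp: agents_def)
  have "wf_profile ?P"
    unfolding wf_profile_def ag by (auto simp: acceptable_def pref_list_def)
  then show "(?P, 0) \<in> esr_instances"
    by (simp add: esr_instances_def)
  have "edges ?P = {}"
    unfolding edges_def ag by (auto simp: acceptable_def pref_list_def)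
  then have "egal_cost ?P M > 0" if "stable ?P M" for M
    using that unfolding egal_cost_def ag
    by (auto simp: stable_def matching_def partner_def acceptable_def pref_list_def)
  then show "\<not> esr_yes (?P, 0)"
    by (force simp: esr_yes_def)
qed


section \<open>Polynomial-time computability\<close>

text \<open>
  The machine model is the WHILE language over binary trees of N. D. Jones (Computability and
  Complexity from a Programming Perspective, 1997), whose polynomial-time computable functions are
  those of Turing machines.  Trees are immutable and subtrees may be shared, so every operation
  (copying a reference, allocating a node, taking a subtree, testing for a leaf) has unit cost.
  There is no constant-time comparison of trees.
\<close>

datatype tree = Leaf | Node tree tree

type_synonym state = "nat \<Rightarrow> tree"

datatype exp = Var nat | LeafE | NodeE exp exp | LeftE exp | RightE exp

fun left :: "tree \<Rightarrow> tree" where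
  "left Leaf = Leaf"
| "left (Node l r) = l"

fun right :: "tree \<Rightarrow> tree" where
  "right Leaf = Leaf"
| "right (Node l r) = r"

fun eval_exp :: "exp \<Rightarrow> state \<Rightarrow> tree" where
  "eval_exp (Var x) s = s x"
| "eval_exp LeafE s = Leaf"
| "eval_exp (NodeE d e) s = Node (eval_exp d s) (eval_exp e s)"
| "eval_exp (LeftE e) s = left (eval_exp e s)"
| "eval_exp (RightE e) s = right (eval_exp e s)"

fun cost_exp :: "exp \<Rightarrow> nat" where
  "cost_exp (Var x) = 1"
| "cost_exp LeafE = 1"
| "cost_exp (NodeE d e) = 1 + cost_exp d + cost_exp e"
| "cost_exp (LeftE e) = 1 + cost_exp e"
| "cost_exp (RightE e) = 1 + cost_exp e"

datatype com =
    Skip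
  | Assign nat exp
  | Seq com com
  | If exp com com
  | While exp com

text \<open>
  \<open>exec c s t s'\<close>: started in state \<open>s\<close>, the program \<open>c\<close> terminates after exactly \<open>t\<close> steps in
  state \<open>s'\<close>.  A test succeeds iff its value is not \<open>Leaf\<close>.
\<close>

inductive exec :: "com \<Rightarrow> state \<Rightarrow> nat \<Rightarrow> state \<Rightarrow> bool" where
  Skip: "exec Skip s 1 s"
| Assign: "exec (Assign x e) s (1 + cost_exp e) (s(x := eval_exp e s))"
| Seq: "exec c1 s t1 s' \<Longrightarrow> exec c2 s' t2 s'' \<Longrightarrow> exec (Seq c1 c2) s (t1 + t2) s''"
| IfTrue: "eval_exp e s \<noteq> Leaf \<Longrightarrow> exec c1 s t s' \<Longrightarrow>
    exec (If e c1 c2) s (1 + cost_exp e + t) s'"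
| IfFalse: "eval_exp e s = Leaf \<Longrightarrow> exec c2 s t s' \<Longrightarrow>
    exec (If e c1 c2) s (1 + cost_exp e + t) s'"
| WhileFalse: "eval_exp e s = Leaf \<Longrightarrow> exec (While e c) s (1 + cost_exp e) s"
| WhileTrue: "eval_exp e s \<noteq> Leaf \<Longrightarrow> exec c s t1 s' \<Longrightarrow> exec (While e c) s' t2 s'' \<Longrightarrow>
    exec (While e c) s (1 + cost_exp e + t1 + t2) s''"

lemma exec_deterministic:
  "exec c s t s' \<Longrightarrow> exec c s u s'' \<Longrightarrow> t = u \<and> s' = s''"
proof (induction arbitrary: u s'' rule: exec.induct)
  case (Skip s)
  then show ?case by (auto elim: exec.cases)
next
  case (Assign x e s)
  then show ?case by (auto elim: exec.cases)
next
  case (Seq c1 s t1 s' c2 t2 r)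
  from Seq.prems show ?case by (cases rule: exec.cases) (use Seq.IH in blast)+
next
  case (IfTrue e s c1 t s' c2)
  from IfTrue.prems show ?case by (cases rule: exec.cases) (use IfTrue in blast)+
next
  case (IfFalse e s c2 t s' c1)
  from IfFalse.prems show ?case by (cases rule: exec.cases) (use IfFalse in blast)+
next
  case (WhileFalse e s c)
  from WhileFalse.prems show ?case by (cases rule: exec.cases) (use WhileFalse in blast)+
next
  case (WhileTrue e s c t1 s' t2 r)
  from WhileTrue.prems show ?case by (cases rule: exec.cases) (use WhileTrue in blast)+
qed

text \<open>
  The program reads its input from variable \<open>0\<close>, all other variables being initially \<open>Leaf\<close>, and
  leaves its output in variable \<open>0\<close>.  The running time is bounded by a polynomial in the number of
  inner nodes of the tree that encodes the input.
\<close>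

definition poly_time_computable ::
  "('a \<Rightarrow> tree) \<Rightarrow> ('b \<Rightarrow> tree) \<Rightarrow> 'a set \<Rightarrow> ('a \<Rightarrow> 'b) \<Rightarrow> bool" where
  "poly_time_computable enc_in enc_out A f \<longleftrightarrow>
     (\<exists>c. \<exists>p :: nat poly. \<forall>x\<in>A. \<exists>t s.
        exec c ((\<lambda>_. Leaf)(0 := enc_in x)) t s \<and>
        s 0 = enc_out (f x) \<and> t \<le> poly p (size (enc_in x)))"

fun enc_bool :: "bool \<Rightarrow> tree" where
  "enc_bool False = Leaf"
| "enc_bool True = Node Leaf Leaf"

fun enc_list :: "('a \<Rightarrow> tree) \<Rightarrow> 'a list \<Rightarrow> tree" where
  "enc_list enc [] = Leaf"
| "enc_list enc (x # xs) = Node (enc x) (enc_list enc xs)"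

text \<open>Numbers, including the cost bound, are written in binary, least significant bit first.\<close>

fun bits :: "nat \<Rightarrow> bool list" where
  "bits n = (if n = 0 then [] else odd n # bits (n div 2))"

declare bits.simps [simp del]

definition enc_nat :: "nat \<Rightarrow> tree" where
  "enc_nat n = enc_list enc_bool (bits n)"

definition enc_instance :: "esr_instance \<Rightarrow> tree" where
  "enc_instance = (\<lambda>(P, \<gamma>). Node (enc_list (enc_list enc_nat) P) (enc_nat \<gamma>))"

end

(*
  Give every agent the list of its acceptable agents and call an entry y of the list of x dead if x is
  not on the list of y; dead entries never occur in a matching but still count in the ranks.  A dead
  first entry costs its owner 1 in every matching, so it may be removed together with one unit of the
  budget g.  Two agents that are each other's first choice are matched in every stable matching at
  cost 0, so both lists may be emptied.  Once there are no mutual first choices, an agent of rank 0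
  has a partner of positive rank, so that the m agents with nonempty lists cost at least m / 2
  together.  Hence m <= 2 g in a yes-instance, no agent can afford a rank above
  r + 1 for r = g - ceil (m / 2), and all lists may be cut to length r + 2.  With a live first
  entry at most r + 1 entries are dead, which is at most 2 g - m unless m = 2 g, and
  in the latter case nobody can remain unmatched, so that a dead second (hence last) entry may be
  dropped.  It remains to renumber the m agents and to let 2 g - m dummy agents with empty lists
  stand for the dead entries.
*)
theory Submission
  imports Defs
begin

section \<open>Stable matchings as involutions\<close>

text \<open>What shapes the proof is that acceptability need not be mutual. A dead entry cannot be
  deleted, because it shifts every later rank and the price of staying unmatched. Nor can it keep
  its name, because then \<open>g\<close> would not bound the number of agents. Only its position
  matters, so any name will do that is new within its list and belongs to an agent that never
  reciprocates. Hence all lists can share one stock of dummies, and a stock of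
  \<open>2 * g - m\<close> brings the number of agents to \<open>2 * g\<close>, which is even, as a
  profile requires. The length \<open>r + 2\<close> is chosen so that an agent with a cut list who
  stays unmatched pays at least \<open>r + 2\<close>, which is still unaffordable; thus cutting
  creates no new solutions. As soon as \<open>m > 0\<close>, it is also at most
  \<open>g + 1\<close>. Clearing or cutting lists makes entries elsewhere dead, so one pass over the
  rules is not enough. Every effective application deletes an entry, so the total length of the
  lists bounds the number of rounds. If the budget is used up while a dead first entry remains, its
  owner keeps \<open>m\<close> positive, and \<open>m > 2 * g\<close> then exposes a
  no-instance.\<close>

definition idx :: "'a list \<Rightarrow> 'a \<Rightarrow> nat" where
  "idx l y = length (takeWhile (\<lambda>z. z \<noteq> y) l)"

lemma idx_Nil [simp]: "idx [] y = 0"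
  by (simp add: idx_def)

lemma idx_Cons: "idx (x # xs) y = (if x = y then 0 else Suc (idx xs y))"
  by (simp add: idx_def)

lemma idx_less_iff: "idx l y < length l \<longleftrightarrow> y \<in> set l"
  by (induction l) (auto simp: idx_Cons)

lemma idx_notin: "y \<notin> set l \<Longrightarrow> idx l y = length l"
  by (induction l) (auto simp: idx_Cons)

lemma idx_le: "idx l y \<le> length l"
  by (simp add: idx_def length_takeWhile_le)

lemma idx_take: "idx (take k l) y = min k (idx l y)"
  by (induction l arbitrary: k) (auto simp: idx_Cons take_Cons split: nat.split)

lemma nth_idx: "y \<in> set l \<Longrightarrow> l ! idx l y = y"
  by (induction l) (auto simp: idx_Cons)

lemma in_set_take_iff: "y \<in> set (take k l) \<longleftrightarrow> y \<in> set l \<and> idx l y < k"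
proof (induction l arbitrary: k)
  case (Cons a l)
  then show ?case by (cases k) (auto simp: idx_Cons)
qed simp

type_synonym prefs = "nat \<Rightarrow> nat list"

definition mutual :: "prefs \<Rightarrow> nat \<Rightarrow> nat \<Rightarrow> bool" where
  "mutual L x y \<longleftrightarrow> y \<in> set (L x) \<and> x \<in> set (L y)"

definition loopless :: "prefs \<Rightarrow> bool" where
  "loopless L \<longleftrightarrow> (\<forall>x. x \<notin> set (L x))"

text \<open>A matching is an involution here, whose fixed points are the unmatched agents.  Since an agent is
  not on its own list, \<open>idx (L x) (\<mu> x)\<close> is the rank of its partner or of being unmatched.\<close>

definition stab :: "prefs \<Rightarrow> (nat \<Rightarrow> nat) \<Rightarrow> bool" where
  "stab L \<mu> \<longleftrightarrow> (\<forall>x. \<mu> (\<mu> x) = x) \<and> (\<forall>x. \<mu> x \<noteq> x \<longrightarrow> \<mu> x \<in> set (L x)) \<and>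
     (\<forall>x y. mutual L x y \<longrightarrow> idx (L x) (\<mu> x) \<le> idx (L x) y \<or> idx (L y) (\<mu> y) \<le> idx (L y) x)"

definition cost :: "nat set \<Rightarrow> prefs \<Rightarrow> (nat \<Rightarrow> nat) \<Rightarrow> nat" where
  "cost A L \<mu> = (\<Sum>x\<in>A. idx (L x) (\<mu> x))"

definition solvable :: "nat set \<Rightarrow> prefs \<Rightarrow> nat \<Rightarrow> bool" where
  "solvable A L g \<longleftrightarrow> (\<exists>\<mu>. stab L \<mu> \<and> cost A L \<mu> \<le> g)"

lemma mutual_sym: "mutual L x y \<longleftrightarrow> mutual L y x"
  by (auto simp: mutual_def)

lemma mutual_nonempty: "mutual L x y \<Longrightarrow> L x \<noteq> [] \<and> L y \<noteq> []"
  by (auto simp: mutual_def)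

lemma stab_involution: "stab L \<mu> \<Longrightarrow> \<mu> (\<mu> x) = x"
  by (simp add: stab_def)

lemma stab_mutual: "stab L \<mu> \<Longrightarrow> \<mu> x \<noteq> x \<Longrightarrow> mutual L x (\<mu> x)"
  unfolding stab_def mutual_def by metis

lemma stab_not_blocked:
  "stab L \<mu> \<Longrightarrow> mutual L x y \<Longrightarrow> idx (L x) (\<mu> x) \<le> idx (L x) y \<or> idx (L y) (\<mu> y) \<le> idx (L y) x"
  by (simp add: stab_def)

text \<open>Being unmatched has the length of the list as its rank, and every actual entry
  \<open>y\<close> is strictly better than that.\<close>

lemma stab_better_matched:
  assumes "loopless L" "mutual L x y" "idx (L x) (\<mu> x) \<le> idx (L x) y"
  shows "\<mu> x \<noteq> x"
  using assms idx_less_iff[of "L x" y] idx_notin[of x "L x"] by (auto simp: loopless_def mutual_def)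

text \<open>Blocking pairs and partners are both mutual, so stability depends only on the relative
  order of the mutual entries of each list. Where the other entries sit, and what they are called,
  is free. Agents outside the image of \<open>\<nu>\<close> have empty lists and stay
  unmatched.\<close>

lemma stab_transfer:
  assumes st: "stab L \<mu>" and ll: "loopless L" and inj: "inj_on \<nu> S"
    and S: "\<And>x. L x \<noteq> [] \<Longrightarrow> x \<in> S" and S': "\<And>z. L' z \<noteq> [] \<Longrightarrow> z \<in> \<nu> ` S"
    and mut: "\<And>x y. x \<in> S \<Longrightarrow> y \<in> S \<Longrightarrow> mutual L' (\<nu> x) (\<nu> y) \<longleftrightarrow> mutual L x y"
    and ord: "\<And>x y z. mutual L x y \<Longrightarrow> mutual L x z \<Longrightarrow> idx (L x) y \<le> idx (L x) z \<Longrightarrow>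
        idx (L' (\<nu> x)) (\<nu> y) \<le> idx (L' (\<nu> x)) (\<nu> z)"
  obtains \<mu>' where "stab L' \<mu>'" "\<And>x. x \<in> S \<Longrightarrow> \<mu>' (\<nu> x) = \<nu> (\<mu> x)" "\<And>z. z \<notin> \<nu> ` S \<Longrightarrow> \<mu>' z = z"
proof -
  define \<mu>' where "\<mu>' z = (if z \<in> \<nu> ` S then \<nu> (\<mu> (inv_into S \<nu> z)) else z)" for z
  have \<mu>': "\<mu>' (\<nu> x) = \<nu> (\<mu> x)" if "x \<in> S" for x
    using that inj by (simp add: \<mu>'_def)
  have out: "\<mu>' z = z" if "z \<notin> \<nu> ` S" for z
    using that by (simp add: \<mu>'_def)
  have inS: "x \<in> S" "y \<in> S" if "mutual L x y" for x y
    using mutual_nonempty[OF that] S by auto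
  have \<mu>S: "\<mu> x \<in> S" if "x \<in> S" for x
    using inS(2)[OF stab_mutual[OF st, of x]] that by (cases "\<mu> x = x") auto
  \<comment> \<open>By \<open>stab_better_matched\<close> the left side concerns a real partner, so
    \<open>ord\<close> is needed for mutual entries only and never for the rank of being
    unmatched.\<close>
  have better: "idx (L' (\<nu> x)) (\<mu>' (\<nu> x)) \<le> idx (L' (\<nu> x)) (\<nu> y)"
    if m: "mutual L x y" and le: "idx (L x) (\<mu> x) \<le> idx (L x) y" for x y
    using ord[OF stab_mutual[OF st stab_better_matched[OF ll m, of \<mu>, OF le]] m le] \<mu>'[OF inS(1)[OF m]] by simp
  have "stab L' \<mu>'"
    unfolding stab_def
  proof (intro conjI allI impI)
    fix z show "\<mu>' (\<mu>' z) = z"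
      using \<mu>' out \<mu>S stab_involution[OF st] by (cases "z \<in> \<nu> ` S") auto
  next
    fix z assume z: "\<mu>' z \<noteq> z"
    then obtain x where x: "x \<in> S" "z = \<nu> x" using out by blast
    then have "\<mu> x \<noteq> x" using z \<mu>' by auto
    then have "mutual L' (\<nu> x) (\<nu> (\<mu> x))"
      using mut[OF x(1) \<mu>S[OF x(1)]] stab_mutual[OF st] by simp
    then show "\<mu>' z \<in> set (L' z)" using x \<mu>' by (simp add: mutual_def)
  next
    fix z w assume zw: "mutual L' z w"
    then have "z \<in> \<nu> ` S" "w \<in> \<nu> ` S" using mutual_nonempty S' by blast+
    then obtain x y where xy: "x \<in> S" "z = \<nu> x" "y \<in> S" "w = \<nu> y" by blast
    then have m: "mutual L x y" using mut zw by simp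
    then show "idx (L' z) (\<mu>' z) \<le> idx (L' z) w \<or> idx (L' w) (\<mu>' w) \<le> idx (L' w) z"
      using stab_not_blocked[OF st m] better[of x y] better[of y x] xy mutual_sym[of L x y] by auto
  qed
  then show ?thesis using that \<mu>' out by blast
qed

lemma stab_cong:
  assumes ll: "loopless L" "loopless L'"
    and mut: "\<And>x y. mutual L' x y \<longleftrightarrow> mutual L x y"
    and ord: "\<And>x y z. mutual L x y \<Longrightarrow> mutual L x z \<Longrightarrow>
        idx (L x) y \<le> idx (L x) z \<longleftrightarrow> idx (L' x) y \<le> idx (L' x) z"
  shows "stab L \<mu> \<longleftrightarrow> stab L' \<mu>"
proof
  assume "stab L \<mu>"
  from this ll(1) inj_on_id2[of UNIV] obtain \<mu>' where "stab L' \<mu>'" "\<And>x. \<mu>' x = \<mu> x"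
    by (rule stab_transfer[where L' = L']) (use mut ord in auto)
  then show "stab L' \<mu>" by (metis ext)
next
  assume "stab L' \<mu>"
  from this ll(2) inj_on_id2[of UNIV] obtain \<mu>' where "stab L \<mu>'" "\<And>x. \<mu>' x = \<mu> x"
    by (rule stab_transfer[where L' = L]) (use mut ord in auto)
  then show "stab L \<mu>" by (metis ext)
qed

text \<open>Deleting the head lowers every rank on the list of \<open>z\<close> except that of
  \<open>y\<close> by exactly one, the rank of being unmatched included. Since \<open>y\<close> is
  never the partner of \<open>z\<close>, the stable involutions stay the same and their costs all
  drop by one.\<close>

lemma solvable_pop:
  assumes A: "finite A" "z \<in> A" and ll: "loopless L" and z: "L z = y # ys" and dead: "z \<notin> set (L y)"
  shows "solvable A L (Suc g) \<longleftrightarrow> solvable A (L(z := ys)) g"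
proof -
  let ?L = "L(z := ys)"
  have zy: "z \<noteq> y" using ll z by (metis loopless_def list.set_intros(1))
  have ll': "loopless ?L" using ll z by (metis fun_upd_apply list.set_intros(2) loopless_def)
  have mut: "mutual ?L a b \<longleftrightarrow> mutual L a b" for a b
    using z dead zy by (auto simp: mutual_def)
  have idx: "idx (L z) b = Suc (idx ys b)" if "b \<noteq> y" for b
    using that z by (simp add: idx_Cons)
  have "b \<noteq> y" if "mutual L z b" for b using that dead by (auto simp: mutual_def)
  then have st: "stab L \<mu> \<longleftrightarrow> stab ?L \<mu>" for \<mu>
    by (intro stab_cong[OF ll ll' mut]) (auto simp: idx)
  have "cost A L \<mu> = Suc (cost A ?L \<mu>)" if "stab L \<mu>" for \<mu>
  proof -
    have "\<mu> z \<noteq> y" using stab_mutual[OF that, of z] dead zy by (auto simp: mutual_def)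
    then have "idx (L z) (\<mu> z) = Suc (idx ys (\<mu> z))" by (rule idx)
    moreover have "(\<Sum>x\<in>A - {z}. idx (L x) (\<mu> x)) = (\<Sum>x\<in>A - {z}. idx (?L x) (\<mu> x))"
      by (intro sum.cong) auto
    ultimately show ?thesis unfolding cost_def using A by (simp add: sum.remove[of A z])
  qed
  then show ?thesis unfolding solvable_def using st by (metis Suc_le_mono)
qed

text \<open>Only the lists of \<open>x\<close> and \<open>y\<close> are emptied. Their names stay on
  the other lists as dead entries, so all other agents keep their ranks, and two agents with empty
  lists cost as little as two first choices.\<close>

lemma solvable_clear:
  assumes A: "finite A" and ll: "loopless L" and x: "L x = y # xs" and y: "L y = x # ys"
  shows "solvable A L g \<longleftrightarrow> solvable A (L(x := [], y := [])) g"
proof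
  let ?L = "L(x := [], y := [])"
  have xy: "x \<noteq> y" using ll x by (metis loopless_def list.set_intros(1))
  have mxy: "mutual L x y" using x y by (simp add: mutual_def)
  {
    assume "solvable A L g"
    then obtain \<mu> where st: "stab L \<mu>" and c: "cost A L \<mu> \<le> g" by (auto simp: solvable_def)
    \<comment> \<open>The pair \<open>x\<close>, \<open>y\<close> does not block, so one of the two
      has rank 0, which here means being matched to the other.\<close>
    have "\<mu> x = y \<or> \<mu> y = x"
      using stab_not_blocked[OF st mxy] x y by (auto simp: idx_Cons split: if_splits)
    then have \<mu>: "\<mu> x = y" "\<mu> y = x" using stab_involution[OF st] by metis+
    let ?\<mu> = "\<mu>(x := x, y := y)"
    have \<mu>ne: "\<mu> a \<noteq> x" "\<mu> a \<noteq> y" if "a \<noteq> x" "a \<noteq> y" for a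
      using that \<mu> stab_involution[OF st, of a] by auto
    have "stab ?L ?\<mu>"
      unfolding stab_def
    proof (intro conjI allI impI)
      show "?\<mu> (?\<mu> a) = a" for a using \<mu>ne[of a] stab_involution[OF st, of a] by auto
      show "?\<mu> a \<in> set (?L a)" if "?\<mu> a \<noteq> a" for a
        using stab_mutual[OF st, of a] that by (auto simp: mutual_def split: if_splits)
      fix a b assume ab: "mutual ?L a b"
      then have "a \<noteq> x" "a \<noteq> y" "b \<noteq> x" "b \<noteq> y" "mutual L a b"
        by (auto simp: mutual_def split: if_splits)
      then show "idx (?L a) (?\<mu> a) \<le> idx (?L a) b \<or> idx (?L b) (?\<mu> b) \<le> idx (?L b) a"
        using stab_not_blocked[OF st] by auto
    qed
    moreover have "cost A ?L ?\<mu> \<le> cost A L \<mu>"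
      unfolding cost_def by (intro sum_mono) auto
    ultimately show "solvable A ?L g" using c by (auto simp: solvable_def intro!: exI[of _ ?\<mu>])
  }
  {
    assume "solvable A ?L g"
    then obtain \<mu> where st: "stab ?L \<mu>" and c: "cost A ?L \<mu> \<le> g" by (auto simp: solvable_def)
    have \<mu>: "\<mu> x = x" "\<mu> y = y"
      using stab_mutual[OF st, of x] stab_mutual[OF st, of y] xy by (auto simp: mutual_def)
    let ?\<mu> = "\<mu>(x := y, y := x)"
    have \<mu>ne: "\<mu> a \<noteq> x" "\<mu> a \<noteq> y" if "a \<noteq> x" "a \<noteq> y" for a
      using that \<mu> stab_involution[OF st, of a] by auto
    have 0: "idx (L x) (?\<mu> x) = 0" "idx (L y) (?\<mu> y) = 0" using x y xy by (auto simp: idx_Cons)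
    have "stab L ?\<mu>"
      unfolding stab_def
    proof (intro conjI allI impI)
      show "?\<mu> (?\<mu> a) = a" for a using \<mu>ne[of a] stab_involution[OF st, of a] xy by auto
      show "?\<mu> a \<in> set (L a)" if "?\<mu> a \<noteq> a" for a
        using stab_mutual[OF st, of a] that x y by (auto simp: mutual_def split: if_splits)
      fix a b assume ab: "mutual L a b"
      show "idx (L a) (?\<mu> a) \<le> idx (L a) b \<or> idx (L b) (?\<mu> b) \<le> idx (L b) a"
      proof (cases "{a, b} \<inter> {x, y} = {}")
        case True
        then have "mutual ?L a b" using ab by (auto simp: mutual_def)
        then show ?thesis using stab_not_blocked[OF st] True by force
      next
        case False
        \<comment> \<open>A pair that meets \<open>{x, y}\<close> contains an agent with its first
          choice and cannot block.\<close>
        then have "a = x \<or> a = y \<or> b = x \<or> b = y" by blast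
        then have "idx (L a) (?\<mu> a) = 0 \<or> idx (L b) (?\<mu> b) = 0"
          by (elim disjE) (simp_all only: 0 simp_thms)
        then show ?thesis by linarith
      qed
    qed
    moreover have "cost A L ?\<mu> \<le> cost A ?L \<mu>"
      unfolding cost_def by (intro sum_mono) (use 0 in auto)
    ultimately show "solvable A L g" using c by (auto simp: solvable_def intro!: exI[of _ ?\<mu>])
  }
qed

section \<open>Rank bounds in the absence of mutual first choices, and what they allow to
  cut\<close>

definition no_tops :: "prefs \<Rightarrow> bool" where
  "no_tops L \<longleftrightarrow> (\<forall>x y. L x \<noteq> [] \<longrightarrow> L y \<noteq> [] \<longrightarrow> hd (L x) = y \<longrightarrow> hd (L y) \<noteq> x)"

text \<open>Without mutual first choices, an agent of rank 0 is matched to one of positive rank.\<close>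

lemma positive_ranks:
  assumes S: "finite S" "\<And>x. L x \<noteq> [] \<longleftrightarrow> x \<in> S" and ll: "loopless L" and nt: "no_tops L"
    and st: "stab L \<mu>"
  defines "B \<equiv> {x \<in> S. idx (L x) (\<mu> x) > 0}"
  shows "card S \<le> 2 * card B" and "u \<in> S \<Longrightarrow> \<mu> u = u \<Longrightarrow> card S < 2 * card B"
proof -
  define Z where "Z = S - B"
  have fin: "finite B" "finite Z" using S by (auto simp: B_def Z_def)
  have SZ: "card S = card Z + card B"
    unfolding Z_def using S by (subst card_Diff_subset) (auto simp: B_def card_mono)
  have inj: "inj_on \<mu> Z" using stab_involution[OF st] by (metis inj_onI)
  \<comment> \<open>The target excludes the unmatched agents. A single unmatched agent thus leaves a
    gap in \<open>B\<close>, which makes the second claim strict.\<close>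
  have sub: "\<mu> ` Z \<subseteq> B - {u. \<mu> u = u}"
  proof safe
    fix x assume x: "x \<in> Z"
    then have Lx: "L x \<noteq> []" "x \<in> S" and z: "idx (L x) (\<mu> x) = 0" using S by (auto simp: Z_def B_def)
    then have hd: "hd (L x) = \<mu> x" by (cases "L x") (auto simp: idx_Cons split: if_splits)
    then have in_: "\<mu> x \<in> set (L x)" using Lx by (metis list.set_sel(1))
    then have ne: "\<mu> x \<noteq> x" using ll by (metis loopless_def)
    then have m: "mutual L x (\<mu> x)" using stab_mutual[OF st] by blast
    then have L\<mu>: "L (\<mu> x) \<noteq> []" by (auto simp: mutual_def)
    then have "hd (L (\<mu> x)) \<noteq> x" using nt hd Lx by (auto simp: no_tops_def)
    then have "idx (L (\<mu> x)) (\<mu> (\<mu> x)) > 0"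
      using L\<mu> stab_involution[OF st, of x] by (cases "L (\<mu> x)") (auto simp: idx_Cons)
    then show "\<mu> x \<in> B" using L\<mu> S by (auto simp: B_def)
    show False if "\<mu> (\<mu> x) = \<mu> x" using that ne stab_involution[OF st, of x] by simp
  qed
  have "card Z \<le> card B"
    using card_inj_on_le[OF inj _ fin(1)] sub by blast
  then show "card S \<le> 2 * card B" using SZ by simp
  assume u: "u \<in> S" "\<mu> u = u"
  \<comment> \<open>\<open>u\<close> is not on its own list, so its rank is the length of a nonempty
    list.\<close>
  then have "idx (L u) (\<mu> u) > 0" using S ll by (auto simp: loopless_def idx_notin)
  then have "u \<in> B" using u by (simp add: B_def)
  moreover have "card Z \<le> card (B - {u})"
    using card_inj_on_le[OF inj _, of "B - {u}"] sub u fin by blast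
  moreover have "card (B - {u}) < card B" using \<open>u \<in> B\<close> fin by (intro card_Diff1_less)
  ultimately show "card S < 2 * card B" using SZ by linarith
qed

text \<open>The cost is concentrated on the set \<open>B\<close> of agents with positive rank, and
  \<open>B\<close> has at least half as many elements as \<open>S\<close>. An agent of rank
  \<open>i\<close> in \<open>B\<close> leaves at least 1 for each of the others, so
  \<open>i + card B - 1 \<le> g\<close>. An unmatched agent would force
  \<open>card S < 2 * card B \<le> 2 * g\<close>.\<close>

lemma rank_bounds:
  assumes A: "finite A" "S \<subseteq> A" and S: "\<And>x. L x \<noteq> [] \<longleftrightarrow> x \<in> S" and ll: "loopless L" and nt: "no_tops L"
    and st: "stab L \<mu>" and g: "cost A L \<mu> \<le> g"
  shows "card S \<le> 2 * g" and "idx (L x) (\<mu> x) + (card S + 1) div 2 \<le> g + 1"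
    and "card S = 2 * g \<Longrightarrow> u \<in> S \<Longrightarrow> \<mu> u \<noteq> u"
proof -
  define B where "B = {x \<in> S. idx (L x) (\<mu> x) > 0}"
  have fin: "finite S" "finite B" using finite_subset[OF A(2,1)] by (auto simp: B_def)
  note pos = positive_ranks[OF fin(1) S ll nt st, folded B_def]
  have cB: "cost A L \<mu> = (\<Sum>x\<in>B. idx (L x) (\<mu> x))"
    unfolding cost_def
  proof (rule sum.mono_neutral_right[OF A(1)])
    show "B \<subseteq> A" using A by (auto simp: B_def)
    show "\<forall>i\<in>A - B. idx (L i) (\<mu> i) = 0"
    proof
      fix i assume "i \<in> A - B"
      then show "idx (L i) (\<mu> i) = 0" using S[of i] by (cases "L i = []") (auto simp: B_def)
    qed
  qed
  have one: "card C \<le> (\<Sum>x\<in>C. idx (L x) (\<mu> x))" if "C \<subseteq> B" for C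
  proof -
    have "(\<Sum>x\<in>C. 1) \<le> (\<Sum>x\<in>C. idx (L x) (\<mu> x))"
      using that by (intro sum_mono) (auto simp: B_def Suc_le_eq)
    then show ?thesis by simp
  qed
  have Bg: "card B \<le> g" using one[of B] cB g by simp
  then show "card S \<le> 2 * g" using pos(1) by simp
  show "idx (L x) (\<mu> x) + (card S + 1) div 2 \<le> g + 1"
  proof (cases "x \<in> B")
    case True
    then have "cost A L \<mu> = idx (L x) (\<mu> x) + (\<Sum>x\<in>B - {x}. idx (L x) (\<mu> x))"
      using cB sum.remove[OF fin(2) True, of "\<lambda>x. idx (L x) (\<mu> x)"] by simp
    moreover have "card (B - {x}) = card B - 1" "card B > 0"
      using True fin card_gt_0_iff by auto
    moreover have "card (B - {x}) \<le> (\<Sum>x\<in>B - {x}. idx (L x) (\<mu> x))" by (rule one) blast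
    ultimately show ?thesis using pos(1) g by linarith
  next
    case False
    then have "idx (L x) (\<mu> x) = 0" using S[of x] by (auto simp: B_def)
    then show ?thesis using pos(1) Bg by simp
  qed
  show "\<mu> u \<noteq> u" if "card S = 2 * g" "u \<in> S" using pos(2)[of u] that Bg by auto
qed

text \<open>A mutual pair that is lost by cutting has a member whose entry lies at position
  \<open>k\<close> or later. That member already does better, so the pair did not block. An
  unmatched agent has a list shorter than \<open>k\<close>, which is not cut at all.\<close>

lemma stab_take:
  assumes k: "\<And>x. idx (L x) (\<mu> x) < k"
  shows "stab L \<mu> \<longleftrightarrow> stab (\<lambda>x. take k (L x)) \<mu>"
proof -
  let ?L = "\<lambda>x. take k (L x)"
  have idx: "idx (?L x) (\<mu> x) = idx (L x) (\<mu> x)" for x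
    using k[of x] by (simp add: idx_take)
  have in_: "\<mu> x \<in> set (?L x) \<longleftrightarrow> \<mu> x \<in> set (L x)" for x
    using k[of x] by (simp add: in_set_take_iff)
  have "(\<forall>x y. mutual L x y \<longrightarrow> idx (L x) (\<mu> x) \<le> idx (L x) y \<or> idx (L y) (\<mu> y) \<le> idx (L y) x) \<longleftrightarrow>
    (\<forall>x y. mutual ?L x y \<longrightarrow> idx (?L x) (\<mu> x) \<le> idx (?L x) y \<or> idx (?L y) (\<mu> y) \<le> idx (?L y) x)"
    unfolding idx
  proof (intro iffI allI impI)
    fix x y
    assume *: "\<forall>x y. mutual L x y \<longrightarrow> idx (L x) (\<mu> x) \<le> idx (L x) y \<or> idx (L y) (\<mu> y) \<le> idx (L y) x"
      and "mutual ?L x y"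
    then show "idx (L x) (\<mu> x) \<le> idx (?L x) y \<or> idx (L y) (\<mu> y) \<le> idx (?L y) x"
      using k[of x] k[of y] by (auto simp: idx_take mutual_def in_set_take_iff)
  next
    fix x y
    assume *: "\<forall>x y. mutual ?L x y \<longrightarrow> idx (L x) (\<mu> x) \<le> idx (?L x) y \<or> idx (L y) (\<mu> y) \<le> idx (?L y) x"
      and m: "mutual L x y"
    show "idx (L x) (\<mu> x) \<le> idx (L x) y \<or> idx (L y) (\<mu> y) \<le> idx (L y) x"
    proof (cases "mutual ?L x y")
      case True
      then show ?thesis using * by (force simp: idx_take)
    next
      case False
      then have "k \<le> idx (L x) y \<or> k \<le> idx (L y) x"
        using m by (auto simp: mutual_def in_set_take_iff)
      then show ?thesis using k[of x] k[of y] by linarith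
    qed
  qed
  then show ?thesis unfolding stab_def in_ by simp
qed

text \<open>Cutting at a positive length preserves the hypotheses of \<open>rank_bounds\<close>, so
  every affordable stable involution has all ranks below \<open>k\<close> in the original and in the
  cut instance alike. There the two costs coincide.\<close>

lemma solvable_take:
  assumes A: "finite A" "S \<subseteq> A" and S: "\<And>x. L x \<noteq> [] \<longleftrightarrow> x \<in> S" and ll: "loopless L" and nt: "no_tops L"
    and k: "k \<ge> g - (card S + 1) div 2 + 2"
  shows "solvable A L g \<longleftrightarrow> solvable A (\<lambda>x. take k (L x)) g"
proof -
  let ?L = "\<lambda>x. take k (L x)"
  have k0: "k > 0" using k by simp
  have S': "?L x \<noteq> [] \<longleftrightarrow> x \<in> S" for x using S k0 by simp
  have ll': "loopless ?L" using ll by (auto simp: loopless_def dest: in_set_takeD)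
  have nt': "no_tops ?L" using nt k0 by (auto simp: no_tops_def)
  have bound: "idx (M x) (\<mu> x) < k"
    if "\<And>x. M x \<noteq> [] \<longleftrightarrow> x \<in> S" "loopless M" "no_tops M" "stab M \<mu>" "cost A M \<mu> \<le> g" for M \<mu> x
    using rank_bounds(2)[OF A that, of x] k by linarith
  have b: "idx (L x) (\<mu> x) < k" if "stab L \<mu>" "cost A L \<mu> \<le> g" for \<mu> x
    using bound[OF S ll nt that] .
  \<comment> \<open>A rank below \<open>k\<close> in the cut list equals the rank in the full list.
    In particular, whoever is unmatched has a list that was not cut.\<close>
  have b': "idx (L x) (\<mu> x) < k" if "stab ?L \<mu>" "cost A ?L \<mu> \<le> g" for \<mu> x
    using bound[OF S' ll' nt' that, of x] by (simp add: idx_take)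
  have c: "cost A ?L \<mu> = cost A L \<mu>" if "\<And>x. idx (L x) (\<mu> x) < k" for \<mu>
    unfolding cost_def using that by (intro sum.cong) (auto simp: idx_take min_absorb2 less_imp_le)
  show ?thesis unfolding solvable_def using b b' c stab_take by metis
qed

text \<open>If there are \<open>2 * g\<close> agents with nonempty lists, then nobody can afford to remain unmatched.\<close>

lemma solvable_drop_last:
  assumes A: "finite A" "S \<subseteq> A" and S: "\<And>x. L x \<noteq> [] \<longleftrightarrow> x \<in> S" and ll: "loopless L" and nt: "no_tops L"
    and m: "card S = 2 * g"
    and L': "\<And>x. L' x = L x \<or> (\<exists>a b. L x = [a, b] \<and> L' x = [a] \<and> x \<notin> set (L b))"
  shows "solvable A L g \<longleftrightarrow> solvable A L' g"
proof -
  have S': "L' x \<noteq> [] \<longleftrightarrow> x \<in> S" for x using S[of x] L'[of x] by auto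
  have sub: "set (L' x) \<subseteq> set (L x)" for x using L'[of x] by auto
  have hd: "hd (L' x) = hd (L x)" for x using L'[of x] by auto
  have ll': "loopless L'" using ll sub by (auto simp: loopless_def)
  have nt': "no_tops L'" using nt by (simp add: no_tops_def hd S S')
  have keep: "y \<in> set (L' x)" if "mutual L x y" for x y
    using L'[of x] that by (auto simp: mutual_def)
  have mut: "mutual L' x y \<longleftrightarrow> mutual L x y" for x y
    using keep[of x y] keep[of y x] sub by (auto simp: mutual_def)
  have idx: "idx (L' x) y = idx (L x) y" if "mutual L x y" for x y
    using L'[of x] that by (auto simp: mutual_def idx_Cons)
  have st: "stab L \<mu> \<longleftrightarrow> stab L' \<mu>" for \<mu>
    by (rule stab_cong[OF ll ll' mut]) (simp add: idx)
  \<comment> \<open>Equality of costs needs everybody in \<open>S\<close> to be matched: dropping a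
    dead last entry would make it cheaper to stay unmatched.\<close>
  have c: "cost A L' \<mu> = cost A L \<mu>" if "stab L \<mu>" "\<And>x. x \<in> S \<Longrightarrow> \<mu> x \<noteq> x" for \<mu>
    unfolding cost_def
  proof (rule sum.cong)
    fix x show "idx (L' x) (\<mu> x) = idx (L x) (\<mu> x)"
    proof (cases "x \<in> S")
      case True
      then show ?thesis using idx stab_mutual that by blast
    next
      case False
      then show ?thesis using S[of x] S'[of x] by simp
    qed
  qed simp
  show ?thesis unfolding solvable_def
    using c st rank_bounds(3)[OF A S ll nt] rank_bounds(3)[OF A S' ll' nt'] m by metis
qed

text \<open>Matched agents keep their rank by \<open>idx\<close>, and unmatched ones pay the length
  of their list, which is why \<open>len\<close> is assumed. Nothing is required of the names of
  dead entries.\<close>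

lemma solvable_rename:
  assumes A: "finite A" "finite B" "S \<subseteq> A" "\<nu> ` S \<subseteq> B"
    and ll: "loopless L" "loopless L'" and inj: "inj_on \<nu> S"
    and S: "\<And>x. L x \<noteq> [] \<Longrightarrow> x \<in> S" and S': "\<And>z. L' z \<noteq> [] \<Longrightarrow> z \<in> \<nu> ` S"
    and mut: "\<And>x y. x \<in> S \<Longrightarrow> y \<in> S \<Longrightarrow> mutual L' (\<nu> x) (\<nu> y) \<longleftrightarrow> mutual L x y"
    and idx: "\<And>x y. mutual L x y \<Longrightarrow> idx (L' (\<nu> x)) (\<nu> y) = idx (L x) y"
    and len: "\<And>x. x \<in> S \<Longrightarrow> length (L' (\<nu> x)) = length (L x)"
    and sol: "solvable A L g"
  shows "solvable B L' g"
proof -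
  obtain \<mu> where st: "stab L \<mu>" and c: "cost A L \<mu> \<le> g" using sol by (auto simp: solvable_def)
  obtain \<mu>' where st': "stab L' \<mu>'" and \<mu>': "\<And>x. x \<in> S \<Longrightarrow> \<mu>' (\<nu> x) = \<nu> (\<mu> x)"
    by (rule stab_transfer[OF st ll(1) inj S S' mut]) (auto simp: idx)
  have eq: "idx (L' (\<nu> x)) (\<mu>' (\<nu> x)) = idx (L x) (\<mu> x)" if x: "x \<in> S" for x
  proof (cases "\<mu> x = x")
    case True
    then show ?thesis using \<mu>'[OF x] ll len[OF x] by (simp add: loopless_def idx_notin)
  next
    case False
    then show ?thesis using \<mu>'[OF x] idx stab_mutual[OF st] by simp
  qed
  \<comment> \<open>Agents outside the image, such as dummies, have empty lists and cost
    nothing.\<close>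
  have "cost B L' \<mu>' = (\<Sum>z\<in>\<nu> ` S. idx (L' z) (\<mu>' z))"
    unfolding cost_def using A S' by (intro sum.mono_neutral_right) (auto, metis idx_Nil image_eqI)
  also have "\<dots> = (\<Sum>x\<in>S. idx (L x) (\<mu> x))"
    using inj eq by (simp add: sum.reindex)
  also have "\<dots> \<le> cost A L \<mu>"
    unfolding cost_def using A by (intro sum_mono2) auto
  finally show ?thesis using st' c by (auto simp: solvable_def)
qed

text \<open>The hypotheses are symmetric: they also hold with both sides exchanged and
  \<open>inv_into S \<nu>\<close> as the renaming.\<close>

lemma solvable_rename_iff:
  assumes A: "finite A" "finite B" "S \<subseteq> A" "\<nu> ` S \<subseteq> B"
    and ll: "loopless L" "loopless L'" and inj: "inj_on \<nu> S"
    and S: "\<And>x. L x \<noteq> [] \<Longrightarrow> x \<in> S" and S': "\<And>z. L' z \<noteq> [] \<Longrightarrow> z \<in> \<nu> ` S"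
    and mut: "\<And>x y. x \<in> S \<Longrightarrow> y \<in> S \<Longrightarrow> mutual L' (\<nu> x) (\<nu> y) \<longleftrightarrow> mutual L x y"
    and idx: "\<And>x y. mutual L x y \<Longrightarrow> idx (L' (\<nu> x)) (\<nu> y) = idx (L x) y"
    and len: "\<And>x. x \<in> S \<Longrightarrow> length (L' (\<nu> x)) = length (L x)"
  shows "solvable A L g \<longleftrightarrow> solvable B L' g"
proof
  show "solvable A L g \<Longrightarrow> solvable B L' g"
    by (rule solvable_rename[OF A ll inj S S' mut idx len])
  let ?i = "inv_into S \<nu>"
  have inv: "?i (\<nu> x) = x" if "x \<in> S" for x using that inj by simp
  have img: "?i ` \<nu> ` S = S" using inv by (force simp: image_iff)
  assume "solvable B L' g"
  then show "solvable A L g"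
  proof (rule solvable_rename[OF A(2,1,4) _ ll(2,1), of ?i, rotated -1])
    show "?i ` \<nu> ` S \<subseteq> A" using img A by simp
    show "inj_on ?i (\<nu> ` S)" by (simp add: inj_on_inv_into)
    show "z \<in> \<nu> ` S" if "L' z \<noteq> []" for z using S' that .
    show "z \<in> ?i ` \<nu> ` S" if "L z \<noteq> []" for z using S that img by simp
    show "mutual L (?i x) (?i y) \<longleftrightarrow> mutual L' x y" if "x \<in> \<nu> ` S" "y \<in> \<nu> ` S" for x y
      using that mut inv by auto
    show "idx (L (?i x)) (?i y) = idx (L' x) y" if m: "mutual L' x y" for x y
    proof -
      obtain a b where ab: "a \<in> S" "b \<in> S" "x = \<nu> a" "y = \<nu> b"
        using mutual_nonempty[OF m] S'[of x] S'[of y] by blast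
      then show ?thesis using mut[of a b] m idx[of a b] inv by simp
    qed
    show "length (L (?i x)) = length (L' x)" if "x \<in> \<nu> ` S" for x
      using that len inv by auto
  qed
qed

section \<open>The reduction rules\<close>

text \<open>The cost bound is kept in unary, as a list over \<^typ>\<open>unit\<close>.\<close>

type_synonym table = "(nat \<times> nat list) list"

text \<open>This and the following operations are built from \<open>fold\<close>,
  \<open>map\<close>, \<open>filter\<close>, \<open>take\<close> and \<open>drop\<close>, so that
  the closure lemmas for \<open>ptime\<close> apply to them. An agent without an entry gets the
  empty list.\<close>

definition lookup :: "table \<Rightarrow> prefs" where
  "lookup W x = fold (\<lambda>e acc. if fst e = x then snd e else acc) W []"

definition modify :: "(nat \<Rightarrow> nat list \<Rightarrow> nat list) \<Rightarrow> table \<Rightarrow> table" where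
  "modify F W = map (\<lambda>e. (fst e, F (fst e) (snd e))) W"

definition head_dead :: "table \<Rightarrow> nat \<times> nat list \<Rightarrow> bool" where
  "head_dead W e = (case snd e of [] \<Rightarrow> False | y # _ \<Rightarrow> fst e \<notin> set (lookup W y))"

definition head_mutual :: "table \<Rightarrow> nat \<times> nat list \<Rightarrow> bool" where
  "head_mutual W e = (case snd e of [] \<Rightarrow> False | y # _ \<Rightarrow>
     (case lookup W y of [] \<Rightarrow> False | x # _ \<Rightarrow> x = fst e))"

definition pop :: "nat \<Rightarrow> table \<Rightarrow> table" where
  "pop z W = modify (\<lambda>x l. if x = z then tl l else l) W"

definition clear :: "nat \<Rightarrow> nat \<Rightarrow> table \<Rightarrow> table" where
  "clear z y W = modify (\<lambda>x l. if x = z \<or> x = y then [] else l) W"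

definition nonempty :: "table \<Rightarrow> table" where
  "nonempty W = filter (\<lambda>e. snd e \<noteq> []) W"

text \<open>Unary subtraction of half the length of \<open>E\<close>. The flag alternates and starts
  with \<open>False\<close>, so the first element already removes a unit and the half is rounded
  up.\<close>

definition half_drop :: "'a list \<Rightarrow> 'b list \<Rightarrow> 'b list" where
  "half_drop E g = snd (fold (\<lambda>_ st. (\<not> fst st, if fst st then snd st else tl (snd st))) E (False, g))"

text \<open>Unary arithmetic: with \<open>m\<close> nonempty lists and budget \<open>g\<close>, the
  test says \<open>2 * g \<le> m\<close>, and the cut length is
  \<open>g - (m + 1) div 2 + 2\<close>. Liveness is tested against the uncut table.\<close>

definition trim :: "table \<Rightarrow> unit list \<Rightarrow> table" where
  "trim W g = modify (\<lambda>x l. if drop (length (nonempty W)) (g @ g) = []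
     then filter (\<lambda>y. x \<in> set (lookup W y)) (take (length (() # () # half_drop (nonempty W) g)) l)
     else take (length (() # () # half_drop (nonempty W) g)) l) W"

text \<open>Trimming is guarded by \<open>m \<le> 2 * g\<close>; beyond that
  \<open>kernelize\<close> rejects anyway. The inner \<open>[]\<close> branch only makes the case
  distinction total, since an entry with an empty list never passes
  \<open>head_mutual\<close>.\<close>

definition clear_or_trim :: "table \<times> unit list \<Rightarrow> table \<times> unit list" where
  "clear_or_trim st = (case filter (head_mutual (fst st)) (fst st) of
     [] \<Rightarrow> if drop (length (snd st @ snd st)) (nonempty (fst st)) = []
           then (trim (fst st) (snd st), snd st) else st
   | e # _ \<Rightarrow> (case snd e of [] \<Rightarrow> st | y # _ \<Rightarrow> (clear (fst e) y (fst st), snd st)))"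

text \<open>With an empty budget a dead first entry cannot be paid for and is left in place. The
  other rules still apply, and the remaining nonempty list leads to rejection.\<close>

definition step :: "table \<times> unit list \<Rightarrow> table \<times> unit list" where
  "step st = (case filter (head_dead (fst st)) (fst st) of
     [] \<Rightarrow> clear_or_trim st
   | e # _ \<Rightarrow> (case snd st of [] \<Rightarrow> clear_or_trim st | _ # g \<Rightarrow> (pop (fst e) (fst st), g)))"

definition proper :: "table \<Rightarrow> bool" where
  "proper W \<longleftrightarrow> distinct (map fst W) \<and> (\<forall>e\<in>set W. distinct (snd e) \<and> fst e \<notin> set (snd e))"

definition ids :: "table \<Rightarrow> nat set" where
  "ids W = fst ` set W"

definition total :: "table \<Rightarrow> nat" where
  "total W = (\<Sum>e\<leftarrow>W. length (snd e))"

section \<open>Tables as representations of preference functions\<close>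

lemma fold_find_notin:
  "x \<notin> key ` set T \<Longrightarrow> fold (\<lambda>e acc. if key e = x then val e else acc) T a = a"
  by (induction T arbitrary: a) auto

lemma fold_find:
  assumes "distinct (map key T)" "e \<in> set T"
  shows "fold (\<lambda>e' acc. if key e' = key e then val e' else acc) T a = val e"
  using assms
proof (induction T arbitrary: a)
  case (Cons e' T)
  then show ?case
    using fold_find_notin[of "key e" key T val] by (cases "e = e'") (auto simp: image_iff)
qed simp

lemma lookup_entry: "proper W \<Longrightarrow> e \<in> set W \<Longrightarrow> lookup W (fst e) = snd e"
  unfolding lookup_def proper_def by (blast intro: fold_find)

lemma lookup_notin: "x \<notin> ids W \<Longrightarrow> lookup W x = []"
  unfolding lookup_def ids_def by (rule fold_find_notin)

text \<open>The hypothesis keeps the default value of agents without an entry intact.\<close>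

lemma lookup_modify: "(\<And>x. F x [] = []) \<Longrightarrow> lookup (modify F W) x = F x (lookup W x)"
proof -
  assume F: "\<And>x. F x [] = []"
  have "fold (\<lambda>e acc. if fst e = x then snd e else acc) (modify F W) (F x a) =
      F x (fold (\<lambda>e acc. if fst e = x then snd e else acc) W a)" for a
    unfolding modify_def by (induction W arbitrary: a) auto
  from this[of "[]"] show ?thesis by (simp add: lookup_def F)
qed

lemma ids_modify [simp]: "ids (modify F W) = ids W"
  by (simp add: ids_def modify_def image_image)

lemma finite_ids [simp]: "finite (ids W)"
  by (simp add: ids_def)

lemma proper_modify:
  assumes "proper W" "\<And>x l. set (F x l) \<subseteq> set l" "\<And>x l. distinct l \<Longrightarrow> distinct (F x l)"
  shows "proper (modify F W)"
proof -
  have "distinct l'" "x \<notin> set l'" if "(x, l') \<in> set (modify F W)" for x l'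
    using that assms(1,3) subsetD[OF assms(2), of x x] by (fastforce simp: proper_def modify_def)+
  moreover have "map fst (modify F W) = map fst W" by (simp add: modify_def)
  ultimately show ?thesis using assms(1) by (auto simp: proper_def)
qed

lemma lookup_nonemptyE:
  assumes "proper W" "lookup W x \<noteq> []"
  obtains e where "e \<in> set W" "fst e = x" "snd e = lookup W x"
  using assms lookup_notin[of x W] lookup_entry by (fastforce simp: ids_def)

lemma lookup_distinct:
  assumes W: "proper W"
  shows "distinct (lookup W x)"
proof (cases "lookup W x = []")
  case False
  then obtain e where "e \<in> set W" "fst e = x" "snd e = lookup W x"
    using lookup_nonemptyE[OF W] by blast
  then show ?thesis using W by (auto simp: proper_def)
qed simp

lemma loopless_lookup: "proper W \<Longrightarrow> loopless (lookup W)"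
  unfolding loopless_def
proof
  fix x assume W: "proper W"
  show "x \<notin> set (lookup W x)"
  proof (cases "lookup W x = []")
    case False
    then obtain e where "e \<in> set W" "fst e = x" "snd e = lookup W x"
      using lookup_nonemptyE[OF W] by blast
    then show ?thesis using W by (auto simp: proper_def)
  qed simp
qed

lemma set_nonempty:
  assumes W: "proper W"
  shows "fst ` set (nonempty W) = {x. lookup W x \<noteq> []}"
proof safe
  fix e assume "e \<in> set (nonempty W)" "lookup W (fst e) = []"
  then show False using lookup_entry[OF W, of e] by (simp add: nonempty_def)
next
  fix x assume x: "lookup W x \<noteq> []"
  obtain e where "e \<in> set W" "fst e = x" "snd e = lookup W x" using lookup_nonemptyE[OF W x] .
  then show "x \<in> fst ` set (nonempty W)" using x by (force simp: nonempty_def)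
qed

lemma distinct_nonempty: "proper W \<Longrightarrow> distinct (map fst (nonempty W))"
  by (simp add: proper_def nonempty_def distinct_map_filter)

lemma card_nonempty: "proper W \<Longrightarrow> card {x. lookup W x \<noteq> []} = length (nonempty W)"
  using set_nonempty[of W] distinct_card[OF distinct_nonempty, of W] by simp

lemma length_half_drop: "length (half_drop E g) = length g - (length E + 1) div 2"
proof -
  have "length (snd (fold (\<lambda>_ st. (\<not> fst st, if fst st then snd st else tl (snd st))) E (b, g))) =
    length g - (length E + (if b then 0 else 1)) div 2" for b
    by (induction E arbitrary: b g) auto
  from this[of False] show ?thesis by (simp add: half_drop_def)
qed

lemma head_dead_iff:
  assumes W: "proper W"
  shows "filter (head_dead W) W = [] \<longleftrightarrow> (\<forall>x. lookup W x \<noteq> [] \<longrightarrow> x \<in> set (lookup W (hd (lookup W x))))"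
proof safe
  fix x assume f: "filter (head_dead W) W = []" and x: "lookup W x \<noteq> []"
  obtain e where "e \<in> set W" "fst e = x" "snd e = lookup W x" using lookup_nonemptyE[OF W x] .
  then show "x \<in> set (lookup W (hd (lookup W x)))"
    using f x by (cases "lookup W x") (auto simp: filter_empty_conv head_dead_def split: list.splits)
next
  assume *: "\<forall>x. lookup W x \<noteq> [] \<longrightarrow> x \<in> set (lookup W (hd (lookup W x)))"
  have "\<not> head_dead W e" if "e \<in> set W" for e
    using *[rule_format, of "fst e"] lookup_entry[OF W that] by (auto simp: head_dead_def split: list.splits)
  then show "filter (head_dead W) W = []" by (simp add: filter_empty_conv)
qed

lemma head_mutual_iff: "proper W \<Longrightarrow> filter (head_mutual W) W = [] \<longleftrightarrow> no_tops (lookup W)"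
proof
  assume W: "proper W" and "filter (head_mutual W) W = []"
  then have *: "\<not> head_mutual W e" if "e \<in> set W" for e using that by (simp add: filter_empty_conv)
  show "no_tops (lookup W)"
    unfolding no_tops_def
  proof (intro allI impI)
    fix x y assume x: "lookup W x \<noteq> []" and y: "lookup W y \<noteq> []" and h: "hd (lookup W x) = y"
    obtain e where "e \<in> set W" "fst e = x" "snd e = lookup W x" using lookup_nonemptyE[OF W x] .
    then show "hd (lookup W y) \<noteq> x"
      using *[of e] x y h by (auto simp: head_mutual_def split: list.splits)
  qed
next
  assume W: "proper W" and nt: "no_tops (lookup W)"
  have "\<not> head_mutual W e" if e: "e \<in> set W" for e
    using nt lookup_entry[OF W e] unfolding no_tops_def
    by (auto simp: head_mutual_def split: list.splits) (metis list.sel(1) list.distinct(1))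
  then show "filter (head_mutual W) W = []" by (simp add: filter_empty_conv)
qed

text \<open>The agents stay the same throughout: those whose lists have become empty remain at cost
  0 and are discarded only when the kernel is written down.\<close>

definition equivalent :: "table \<times> unit list \<Rightarrow> table \<times> unit list \<Rightarrow> bool" where
  "equivalent st st' \<longleftrightarrow> proper (fst st') \<and> ids (fst st') = ids (fst st) \<and>
     length (snd st') \<le> length (snd st) \<and>
     (solvable (ids (fst st)) (lookup (fst st)) (length (snd st)) \<longleftrightarrow>
      solvable (ids (fst st')) (lookup (fst st')) (length (snd st')))"

lemma equivalent_refl: "proper (fst st) \<Longrightarrow> equivalent st st"
  by (simp add: equivalent_def)

lemma equivalent_trans: "equivalent a b \<Longrightarrow> equivalent b c \<Longrightarrow> equivalent a c"
  by (auto simp: equivalent_def)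

lemma equivalent_pop:
  assumes W: "proper W" and e: "e \<in> set W" "head_dead W e"
  shows "equivalent (W, u # g) (pop (fst e) W, g)"
proof -
  obtain y ys where l: "lookup W (fst e) = y # ys" and dead: "fst e \<notin> set (lookup W y)"
    using e lookup_entry[OF W e(1)] by (auto simp: head_dead_def split: list.splits)
  have "lookup (pop (fst e) W) = (lookup W)(fst e := ys)"
    using l by (auto simp: pop_def lookup_modify)
  moreover have "set (tl l) \<subseteq> set l" for l :: "nat list" by (cases l) auto
  then have "proper (pop (fst e) W)"
    unfolding pop_def by (intro proper_modify[OF W]) (auto intro: distinct_tl)
  moreover have "fst e \<in> ids W" using e by (simp add: ids_def)
  ultimately show ?thesis
    using solvable_pop[OF _ _ loopless_lookup[OF W] l dead, of "ids W" "length g"]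
    by (simp add: equivalent_def) (simp add: pop_def)
qed

lemma equivalent_clear:
  assumes W: "proper W" and e: "e \<in> set W" "head_mutual W e" "snd e = y # ys"
  shows "equivalent (W, g) (clear (fst e) y W, g)"
proof -
  obtain zs where y: "lookup W y = fst e # zs"
    using e by (auto simp: head_mutual_def split: list.splits)
  have x: "lookup W (fst e) = y # ys" using lookup_entry[OF W e(1)] e by simp
  have "lookup (clear (fst e) y W) = (lookup W)(fst e := [], y := [])"
    by (auto simp: clear_def lookup_modify)
  moreover have "proper (clear (fst e) y W)"
    unfolding clear_def by (rule proper_modify[OF W]) auto
  ultimately show ?thesis
    using solvable_clear[OF _ loopless_lookup[OF W] x y, of "ids W" "length g"]
    by (simp add: equivalent_def) (simp add: clear_def)
qed

lemma lookup_trim: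
  "lookup (trim W g) x =
    (if 2 * length g \<le> length (nonempty W)
     then filter (\<lambda>y. x \<in> set (lookup W y)) (take (length g - (length (nonempty W) + 1) div 2 + 2) (lookup W x))
     else take (length g - (length (nonempty W) + 1) div 2 + 2) (lookup W x))"
  unfolding trim_def by (subst lookup_modify) (auto simp: length_half_drop mult_2)

lemma equivalent_trim:
  assumes W: "proper W" and live: "filter (head_dead W) W = [] \<or> g = []"
    and nt: "filter (head_mutual W) W = []"
    and m: "drop (length (g @ g)) (nonempty W) = []"
  shows "equivalent (W, g) (trim W g, g)"
proof -
  define L where "L = lookup W"
  define S where "S = {x. L x \<noteq> []}"
  define m where "m = length (nonempty W)"
  define k where "k = length g - (m + 1) div 2 + 2"
  define T where "T = (\<lambda>x. take k (L x))"
  have cS: "card S = m" using card_nonempty[OF W] by (simp add: S_def L_def m_def)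
  have m_le: "m \<le> 2 * length g" using assms(4) by (simp add: m_def)
  have SA: "S \<subseteq> ids W" using lookup_notin by (auto simp: S_def L_def)
  have S: "L x \<noteq> [] \<longleftrightarrow> x \<in> S" for x by (simp add: S_def)
  have ll: "loopless L" unfolding L_def by (rule loopless_lookup[OF W])
  have nt': "no_tops L" using nt head_mutual_iff[OF W] by (simp add: L_def)
  have T: "solvable (ids W) L (length g) \<longleftrightarrow> solvable (ids W) T (length g)"
    unfolding T_def by (rule solvable_take[OF finite_ids SA S ll nt']) (simp add: k_def cS)
  have L': "lookup (trim W g) x =
    (if 2 * length g \<le> m then filter (\<lambda>y. x \<in> set (L y)) (T x) else T x)" for x
    unfolding lookup_trim by (simp add: T_def L_def k_def m_def)
  have "solvable (ids W) T (length g) \<longleftrightarrow> solvable (ids W) (lookup (trim W g)) (length g)"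
  proof (cases "2 * length g \<le> m")
    case True
    then have m2: "card S = 2 * length g" using m_le cS by simp
    \<comment> \<open>Here half of \<open>m\<close> uses up the whole budget, and only the
      additional 2 remains.\<close>
    then have k: "k = 2" using cS by (simp add: k_def)
    show ?thesis
    proof (rule solvable_drop_last[OF finite_ids SA _ _ _ m2])
      show "T x \<noteq> [] \<longleftrightarrow> x \<in> S" for x using S k by (simp add: T_def)
      show "loopless T" using ll by (auto simp: T_def loopless_def dest: in_set_takeD)
      show "no_tops T" using nt' k by (auto simp: T_def no_tops_def)
      fix x
      let ?P = "\<lambda>y. x \<in> set (L y)"
      show "lookup (trim W g) x = T x \<or>
          (\<exists>a b. T x = [a, b] \<and> lookup (trim W g) x = [a] \<and> x \<notin> set (T b))"
      proof (cases "L x = []")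
        case True
        then show ?thesis by (simp add: L' T_def)
      next
        case False
        \<comment> \<open>A nonempty list makes \<open>m\<close> positive, hence also the budget,
          which rules out the second alternative of \<open>live\<close>.\<close>
        then have "g \<noteq> []" using S[of x] cS m_le finite_subset[OF SA] by (auto simp: card_eq_0_iff)
        then have hd: "?P (hd (L x))" using live head_dead_iff[OF W] False by (simp add: L_def)
        consider a where "L x = [a]" | a b l where "L x = a # b # l"
          using False by (metis neq_Nil_conv)
        then show ?thesis
        proof cases
          case 1
          then show ?thesis using hd k True by (simp add: L' T_def)
        next
          case 2
          then have "T x = [a, b]" using k by (simp add: T_def eval_nat_numeral)
          moreover have "?P a" using 2 hd by simp
          \<comment> \<open>The filter removes entries that are dead in the uncut lists; these are
            all the more dead after cutting.\<close>
          moreover have "set (T b) \<subseteq> set (L b)" by (simp add: T_def set_take_subset)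
          ultimately show ?thesis using True by (auto simp: L')
        qed
      qed
    qed
  next
    case False
    then have "lookup (trim W g) = T" by (intro ext) (simp add: L')
    then show ?thesis by simp
  qed
  moreover have "proper (trim W g)"
    unfolding trim_def
    by (rule proper_modify[OF W]) (auto dest: in_set_takeD)
  ultimately show ?thesis using T by (simp add: equivalent_def L_def) (simp add: trim_def)
qed

lemma filter_eq_ConsD_set: "filter P xs = y # ys \<Longrightarrow> y \<in> set xs \<and> P y"
  by (auto simp: filter_eq_Cons_iff)

lemma equivalent_clear_or_trim:
  assumes W: "proper (fst st)" and live: "filter (head_dead (fst st)) (fst st) = [] \<or> snd st = []"
  shows "equivalent st (clear_or_trim st)"
proof (cases st)
  case (Pair W g)
  then show ?thesis
    using assms equivalent_trim[of W g] equivalent_clear[of W _ _ _ g] equivalent_refl[of st]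
    by (auto simp: clear_or_trim_def dest!: filter_eq_ConsD_set split: list.split)
qed

lemma equivalent_step:
  assumes W: "proper (fst st)"
  shows "equivalent st (step st)"
proof (cases st)
  case (Pair W g)
  then show ?thesis
    using assms equivalent_pop[of W] equivalent_clear_or_trim[of st]
    by (auto simp: step_def dest!: filter_eq_ConsD_set split: list.split)
qed

section \<open>Termination of the reduction\<close>

lemma total_modify_le:
  assumes "\<And>x l. length (F x l) \<le> length l"
  shows "total (modify F W) \<le> total W"
  unfolding total_def modify_def using assms by (induction W) (auto intro: add_mono)

lemma total_modify_less:
  assumes "\<And>x l. length (F x l) \<le> length l" and e: "e \<in> set W" "length (F (fst e) (snd e)) < length (snd e)"
  shows "total (modify F W) < total W"
  using e
proof (induction W)
  case (Cons e' W)
  have "length (F (fst e') (snd e')) \<le> length (snd e')" by (rule assms)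
  moreover have "total (modify F W) \<le> total W" by (rule total_modify_le) (rule assms)
  ultimately show ?case using Cons by (auto simp: total_def modify_def)
qed simp

text \<open>For a rule that only deletes entries, \<open>total\<close> detects every change.\<close>

lemma modify_eq_or_less:
  assumes le: "\<And>x l. length (F x l) \<le> length l" and eq: "\<And>x l. length (F x l) = length l \<Longrightarrow> F x l = l"
  shows "modify F W = W \<or> total (modify F W) < total W"
proof (cases "\<exists>e\<in>set W. length (F (fst e) (snd e)) < length (snd e)")
  case True
  then show ?thesis using total_modify_less[of F, OF le] by blast
next
  case False
  then have "F (fst e) (snd e) = snd e" if "e \<in> set W" for e
    using that le[of "fst e" "snd e"] eq by (metis le_neq_implies_less)
  then show ?thesis by (simp add: modify_def map_idI)
qed

lemma trim_eq_or_less: "trim W g = W \<or> total (trim W g) < total W"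
  unfolding trim_def
proof (rule modify_eq_or_less, goal_cases)
  case (1 x l)
  have "length (filter P (take n l)) \<le> length l" for P n
    using length_filter_le[of P "take n l"] by simp
  then show ?case by (simp del: length_take) simp
next
  case (2 x l)
  have take: "take n l = l" if "length (take n l) = length l" for n using that by simp
  have "filter P (take n l) = l" if "length (filter P (take n l)) = length l" for P n
  proof -
    have "length (filter P (take n l)) \<le> length (take n l)" by (rule length_filter_le)
    then have "take n l = l" using that by simp
    then show ?thesis using that by (metis filter_id_conv length_filter_less nat_neq_iff)
  qed
  then show ?case using 2 take
    by (cases "drop (length (nonempty W)) (g @ g) = []") (simp_all only: if_True if_False simp_thms)
qed

lemma total_clear:
  assumes "e \<in> set W" "snd e \<noteq> []"
  shows "total (clear (fst e) y W) < total W"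
  unfolding clear_def by (rule total_modify_less[OF _ assms(1)]) (use assms in auto)

lemma clear_or_trim_eq_or_less:
  "clear_or_trim st = st \<or> total (fst (clear_or_trim st)) < total (fst st)"
proof (cases "filter (head_mutual (fst st)) (fst st)")
  case Nil
  then show ?thesis using trim_eq_or_less[of "fst st" "snd st"] by (cases st) (auto simp: clear_or_trim_def)
next
  case (Cons e es)
  then have e: "e \<in> set (fst st)" "head_mutual (fst st) e" using filter_eq_ConsD_set by fast+
  then obtain y ys where "snd e = y # ys" by (auto simp: head_mutual_def split: list.splits)
  then show ?thesis using Cons total_clear[OF e(1), of y] by (simp add: clear_or_trim_def)
qed

lemma total_pop:
  assumes "e \<in> set W" "head_dead W e"
  shows "total (pop (fst e) W) < total W"
  unfolding pop_def by (rule total_modify_less[OF _ assms(1)]) (use assms in \<open>auto simp: head_dead_def split: list.splits\<close>)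

lemma step_eq_or_less: "step st = st \<or> total (fst (step st)) < total (fst st)"
proof (cases "filter (head_dead (fst st)) (fst st)")
  case Nil
  then show ?thesis using clear_or_trim_eq_or_less[of st] by (simp add: step_def)
next
  case (Cons e es)
  then have "e \<in> set (fst st)" "head_dead (fst st) e" using filter_eq_ConsD_set by fast+
  then show ?thesis
    using Cons total_pop clear_or_trim_eq_or_less[of st] by (auto simp: step_def split: list.split)
qed

text \<open>Every step that changes the state lowers \<open>total\<close>. A loop that runs until
  nothing changes may thus be replaced by a fixed number of rounds, which a \<open>fold\<close> can
  express.\<close>

lemma step_funpow_fixed: "total (fst st) \<le> n \<Longrightarrow> step ((step ^^ n) st) = (step ^^ n) st"
proof (induction n arbitrary: st)
  case 0
  then show ?case using step_eq_or_less[of st] by auto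
next
  case (Suc n)
  show ?case
  proof (cases "step st = st")
    case True
    then have "(step ^^ k) st = st" for k by (induction k) auto
    then show ?thesis using True by metis
  next
    case False
    then have "total (fst (step st)) \<le> n" using step_eq_or_less[of st] Suc.prems by simp
    then show ?thesis using Suc.IH by (simp add: funpow_swap1)
  qed
qed

lemma equivalent_funpow: "proper (fst st) \<Longrightarrow> equivalent st ((step ^^ n) st)"
proof (induction n)
  case (Suc n)
  then have "equivalent st ((step ^^ n) st)" by simp
  moreover from this have "equivalent ((step ^^ n) st) (step ((step ^^ n) st))"
    by (intro equivalent_step) (simp add: equivalent_def)
  ultimately show ?case using equivalent_trans by simp
qed (simp add: equivalent_refl)

text \<open>At a fixed point no rule has an effect: popping would shorten the budget, and clearing
  would lower \<open>total\<close>.\<close>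

lemma step_fixed:
  assumes "step (W, g) = (W, g)"
  shows "filter (head_dead W) W = [] \<or> g = []" and "filter (head_mutual W) W = []"
    and "length (nonempty W) \<le> 2 * length g \<Longrightarrow> trim W g = W"
proof -
  show a: "filter (head_dead W) W = [] \<or> g = []"
  proof (rule ccontr)
    assume "\<not> ?thesis"
    then show False using assms by (auto simp: step_def neq_Nil_conv)
  qed
  then have c: "clear_or_trim (W, g) = (W, g)"
    using assms by (auto simp: step_def split: list.splits)
  show b: "filter (head_mutual W) W = []"
  proof (rule ccontr)
    assume "\<not> ?thesis"
    then obtain e es where f: "filter (head_mutual W) W = e # es" by (auto simp: neq_Nil_conv)
    then have e: "e \<in> set W" "head_mutual W e" using filter_eq_ConsD_set[OF f] by auto
    then obtain y ys where y: "snd e = y # ys" by (auto simp: head_mutual_def split: list.splits)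
    then have "clear (fst e) y W = W" using c f by (simp add: clear_or_trim_def)
    then show False using total_clear[OF e(1), of y] y by simp
  qed
  show "trim W g = W" if "length (nonempty W) \<le> 2 * length g"
    using c b that by (simp add: clear_or_trim_def)
qed

section \<open>Renumbering the agents\<close>

text \<open>The entries of \<open>l\<close> that violate \<open>P\<close> are replaced by successive elements of \<open>D\<close>; they are dropped
  once \<open>D\<close> is exhausted.\<close>

fun place :: "('a \<Rightarrow> bool) \<Rightarrow> ('a \<Rightarrow> 'b) \<Rightarrow> 'a list \<Rightarrow> 'b list \<Rightarrow> 'b list" where
  "place P \<nu> [] D = []"
| "place P \<nu> (y # ys) D = (if P y then \<nu> y # place P \<nu> ys D
     else (case D of [] \<Rightarrow> place P \<nu> ys [] | d # D' \<Rightarrow> d # place P \<nu> ys D'))"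

lemma length_place: "length (filter (\<lambda>y. \<not> P y) l) \<le> length D \<Longrightarrow> length (place P \<nu> l D) = length l"
  by (induction P \<nu> l D rule: place.induct) (auto split: list.splits)

lemma set_place_subset: "set (place P \<nu> l D) \<subseteq> \<nu> ` {y \<in> set l. P y} \<union> set D"
proof (induction l arbitrary: D)
  case (Cons y ys)
  show ?case
  proof (cases "P y")
    case True
    then show ?thesis using Cons[of D] by auto
  next
    case False
    then show ?thesis using Cons[of "[]"] Cons[of "tl D"] by (cases D) auto
  qed
qed simp

lemma place_live: "y \<in> set l \<Longrightarrow> P y \<Longrightarrow> \<nu> y \<in> set (place P \<nu> l D)"
  by (induction P \<nu> l D rule: place.induct) (auto split: list.splits)

text \<open>With enough dummies every entry before \<open>y\<close> still occupies one place. None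
  of them becomes \<open>\<nu> y\<close>: the live ones because \<open>\<nu>\<close> separates them
  from \<open>y\<close>, the dummies because \<open>\<nu> y\<close> is not in
  \<open>D\<close>.\<close>

lemma idx_place:
  assumes "length (filter (\<lambda>z. \<not> P z) l) \<le> length D" "P y"
    and "\<And>z. z \<in> set l \<Longrightarrow> P z \<Longrightarrow> \<nu> z = \<nu> y \<Longrightarrow> z = y" "\<nu> y \<notin> set D" "y \<in> set l"
  shows "idx (place P \<nu> l D) (\<nu> y) = idx l y"
  using assms
proof (induction l arbitrary: D)
  case (Cons z l)
  show ?case
  proof (cases "P z")
    case True
    then show ?thesis using Cons.IH[of D] Cons.prems by (auto simp: idx_Cons)
  next
    case False
    then obtain d D' where "D = d # D'" using Cons.prems(1) by (cases D) auto
    then show ?thesis using False Cons.IH[of D'] Cons.prems by (auto simp: idx_Cons)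
  qed
qed simp

lemma distinct_place:
  assumes "distinct l" "distinct D" "inj_on \<nu> {y \<in> set l. P y}" "\<nu> ` {y \<in> set l. P y} \<inter> set D = {}"
  shows "distinct (place P \<nu> l D)"
  using assms
proof (induction l arbitrary: D)
  case (Cons z l)
  have inj: "inj_on \<nu> {y \<in> set l. P y}" using Cons.prems(3) by (rule inj_on_subset) auto
  show ?case
  proof (cases "P z")
    case True
    have "\<nu> z \<notin> \<nu> ` {y \<in> set l. P y}"
      using Cons.prems(1,3) True by (auto dest!: inj_onD)
    moreover have "\<nu> z \<notin> set D" using Cons.prems(4) True by auto
    ultimately have "\<nu> z \<notin> set (place P \<nu> l D)" using set_place_subset[of P \<nu> l D] by blast
    moreover have "distinct (place P \<nu> l D)" using Cons.prems inj by (intro Cons.IH) auto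
    ultimately show ?thesis using True by simp
  next
    case False
    show ?thesis
    proof (cases D)
      case Nil
      then show ?thesis using False Cons.IH[of "[]"] Cons.prems inj by auto
    next
      case D: (Cons d D')
      have "d \<notin> set (place P \<nu> l D')"
        using set_place_subset[of P \<nu> l D'] Cons.prems(2,4) D by auto
      moreover have "distinct (place P \<nu> l D')" using Cons.prems D inj by (intro Cons.IH) auto
      ultimately show ?thesis using False D by simp
    qed
  qed
qed simp

section \<open>Numbers for the surviving agents and for the dummies\<close>

definition enum :: "'a list \<Rightarrow> (nat \<times> 'a) list" where
  "enum xs = rev (snd (fold (\<lambda>x st. (Suc (fst st), (fst st, x) # snd st)) xs (1, [])))"

lemma fold_enum: "fold (\<lambda>x st. (Suc (fst st), (fst st, x) # snd st)) xs (k, acc) =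
    (k + length xs, rev (zip [k..<k + length xs] xs) @ acc)"
proof (induction xs arbitrary: k acc)
  case (Cons x xs)
  have "[k..<k + length (x # xs)] = k # [Suc k..<Suc k + length xs]" by (subst upt_conv_Cons) auto
  then show ?case using Cons[of "Suc k" "(k, x) # acc"] by simp
qed simp

lemma enum_eq: "enum xs = zip [1..<Suc (length xs)] xs"
  by (simp add: enum_def fold_enum)

lemma map_fst_enum: "map fst (enum xs) = [1..<Suc (length xs)]"
  by (simp add: enum_eq del: upt_Suc)

lemma map_snd_enum: "map snd (enum xs) = xs"
  by (simp add: enum_eq del: upt_Suc)

lemma in_set_enum: "(i, x) \<in> set (enum xs) \<longleftrightarrow> 1 \<le> i \<and> i \<le> length xs \<and> x = xs ! (i - 1)"
proof -
  have "(i, x) \<in> set (enum xs) \<longleftrightarrow> (\<exists>k<length xs. i = Suc k \<and> x = xs ! k)"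
    by (auto simp: enum_eq set_zip simp del: upt_Suc) (rule_tac x = k in exI, simp del: upt_Suc)
  also have "\<dots> \<longleftrightarrow> 1 \<le> i \<and> i \<le> length xs \<and> x = xs ! (i - 1)"
    by (cases i) auto
  finally show ?thesis .
qed

text \<open>The position in \<open>E\<close>, counted from 1, found by searching the enumerated
  table for its key. The default 0 is not the number of any agent; it is harmless, since only live
  entries are renamed.\<close>

definition number :: "table \<Rightarrow> nat \<Rightarrow> nat" where
  "number E y = fold (\<lambda>e acc. if fst (snd e) = y then fst e else acc) (enum E) 0"

lemma number_nth:
  assumes "distinct (map fst E)" "i < length E"
  shows "number E (fst (E ! i)) = Suc i"
proof -
  have "map (\<lambda>e. fst (snd e)) (enum E) = map fst E"
  proof -
    have "map (\<lambda>e. fst (snd e)) (enum E) = map fst (map snd (enum E))" by simp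
    also have "map snd (enum E) = E" by (rule map_snd_enum)
    finally show ?thesis .
  qed
  moreover have "(Suc i, E ! i) \<in> set (enum E)"
    using assms(2) by (simp add: in_set_enum)
  ultimately show ?thesis
    using fold_find[of "\<lambda>e. fst (snd e)" "enum E" "(Suc i, E ! i)" fst 0] assms(1)
    by (simp add: number_def)
qed

text \<open>The numbers above \<open>length E\<close> up to twice the budget, obtained by walking
  along unary lists instead of by arithmetic.\<close>

definition dummies :: "table \<Rightarrow> unit list \<Rightarrow> nat list" where
  "dummies E g = drop (length E) (map fst (enum (g @ g)))"

lemma dummies_eq: "dummies E g = [Suc (length E)..<Suc (2 * length g)]"
proof -
  show ?thesis by (simp add: dummies_def mult_2 map_fst_enum del: upt_Suc)
qed

definition renumber :: "table \<Rightarrow> nat list \<Rightarrow> nat \<times> nat list \<Rightarrow> nat list" where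
  "renumber W D e = place (\<lambda>y. fst e \<in> set (lookup W y)) (number (nonempty W)) (snd e) D"

text \<open>The test detects more than \<open>2 * g\<close> nonempty lists. The constant in that
  case is a no-instance, because agent 1 pays 1 for an entry that is not reciprocated.\<close>

definition kernelize :: "table \<times> unit list \<Rightarrow> profile \<times> nat" where
  "kernelize st = (let W = fst st; g = snd st; E = nonempty W; D = dummies E g in
     if drop (length (g @ g)) E \<noteq> [] then ([[2], []], 0)
     else (map (renumber W D) E @ map (\<lambda>_. []) D, length g))"

definition prefs_of :: "profile \<Rightarrow> prefs" where
  "prefs_of P x = (if x \<in> agents P then pref_list P x else [])"

lemma in_set_prefs_of: "y \<in> set (prefs_of P x) \<longleftrightarrow> x \<in> agents P \<and> y \<in> set (pref_list P x)"
  by (cases "x \<in> agents P") (simp_all add: prefs_of_def)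

lemma lookup_enum: "lookup (enum P) = prefs_of P"
proof
  fix x
  show "lookup (enum P) x = prefs_of P x"
  proof (cases "x \<in> agents P")
    case True
    then have "(x, P ! (x - 1)) \<in> set (enum P)"
      by (auto simp: in_set_enum agents_def)
    moreover have "distinct (map fst (enum P))" by (simp add: map_fst_enum del: upt_Suc)
    ultimately have "lookup (enum P) x = P ! (x - 1)"
      unfolding lookup_def using fold_find[of fst "enum P" "(x, P ! (x - 1))" snd "[]"] by simp
    then show ?thesis using True by (simp add: prefs_of_def pref_list_def)
  next
    case False
    then have "x \<notin> ids (enum P)" by (auto simp: ids_def in_set_enum agents_def)
    then show ?thesis using False by (simp add: lookup_notin prefs_of_def)
  qed
qed

lemma ids_enum: "ids (enum P) = agents P"
proof -
  have "ids (enum P) = set (map fst (enum P))" by (simp add: ids_def)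
  also have "\<dots> = agents P" by (auto simp: map_fst_enum agents_def simp del: upt_Suc)
  finally show ?thesis .
qed

lemma proper_enum:
  assumes "wf_profile P"
  shows "proper (enum P)"
proof -
  have "distinct l \<and> x \<notin> set l" if "(x, l) \<in> set (enum P)" for x l
  proof -
    have "x \<in> agents P \<and> l = pref_list P x"
      using that by (auto simp: in_set_enum agents_def pref_list_def)
    then show ?thesis using assms by (auto simp: wf_profile_def acceptable_def)
  qed
  then show ?thesis by (auto simp: proper_def map_fst_enum simp del: upt_Suc)
qed

lemma total_enum: "total (enum P) = length (concat P)"
proof -
  have "total (enum P) = sum_list (map length (map snd (enum P)))" by (simp add: total_def comp_def)
  also have "map snd (enum P) = P" by (rule map_snd_enum)
  finally show ?thesis by (simp add: length_concat)
qed

text \<open>The second bound is the number of available dummies, so that each dead entry of a list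
  can get its own.\<close>

lemma dead_count:
  assumes W: "proper W" and live: "filter (head_dead W) W = [] \<or> g = []"
    and m: "length (nonempty W) \<le> 2 * length g" and trim: "trim W g = W"
  shows "length (lookup W x) \<le> length g - (length (nonempty W) + 1) div 2 + 2"
    and "length (filter (\<lambda>y. x \<notin> set (lookup W y)) (lookup W x)) \<le> 2 * length g - length (nonempty W)"
proof -
  let ?k = "length g - (length (nonempty W) + 1) div 2 + 2"
  let ?dead = "filter (\<lambda>y. x \<notin> set (lookup W y)) (lookup W x)"
  have eq: "lookup W x = (if 2 * length g \<le> length (nonempty W)
     then filter (\<lambda>y. x \<in> set (lookup W y)) (take ?k (lookup W x)) else take ?k (lookup W x))"
    using lookup_trim[of W g x] trim by simp
  show len: "length (lookup W x) \<le> ?k"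
  proof (cases "2 * length g \<le> length (nonempty W)")
    case True
    then have "length (lookup W x) \<le> length (take ?k (lookup W x))"
      using eq length_filter_le by metis
    then show ?thesis by simp
  next
    case False
    then have "lookup W x = take ?k (lookup W x)" using eq by simp
    then show ?thesis by (metis length_take min.cobounded2)
  qed
  show "length ?dead \<le> 2 * length g - length (nonempty W)"
  proof (cases "2 * length g \<le> length (nonempty W)")
    case True
    \<comment> \<open>The filter left the list unchanged, so the list contains no dead
      entries.\<close>
    then have "lookup W x = filter (\<lambda>y. x \<in> set (lookup W y)) (take ?k (lookup W x))"
      using eq by simp
    from arg_cong[OF this, of set] have "\<forall>y\<in>set (lookup W x). x \<in> set (lookup W y)"
      by auto
    then show ?thesis by (simp add: filter_empty_conv[THEN iffD2])
  next
    case lt: False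
    show ?thesis
    proof (cases "lookup W x")
      case (Cons a l)
      have "g \<noteq> []" using lt by auto
      then have "\<forall>x. lookup W x \<noteq> [] \<longrightarrow> x \<in> set (lookup W (hd (lookup W x)))"
        using live head_dead_iff[OF W] by simp
      from this[rule_format, of x] have "x \<in> set (lookup W a)" using Cons by simp
      then have "length ?dead \<le> length l" using Cons by simp
      \<comment> \<open>With \<open>r = length g - (m + 1) div 2\<close>, at most
        \<open>r + 1\<close> entries follow the live head. For odd \<open>m\<close> there are
        \<open>2 * r + 1\<close> dummies. For even \<open>m\<close> there are \<open>2 * r\<close>,
        which suffices because \<open>m < 2 * length g\<close> gives
        \<open>r \<ge> 1\<close>.\<close>
      then show ?thesis using len Cons lt by simp
    qed simp
  qed
qed

section \<open>Matchings as edge sets and as involutions\<close>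

lemma prefers_iff:
  assumes "distinct (pref_list P x)"
  shows "prefers P x y z \<longleftrightarrow> y \<in> set (pref_list P x) \<and> z \<in> set (pref_list P x) \<and>
    idx (pref_list P x) y < idx (pref_list P x) z"
proof
  assume "prefers P x y z"
  then obtain k l where kl: "k < l" "l < length (pref_list P x)" "pref_list P x ! k = y" "pref_list P x ! l = z"
    by (auto simp: prefers_def)
  have "idx (pref_list P x) (pref_list P x ! i) = i" if "i < length (pref_list P x)" for i
    using assms that by (metis idx_less_iff nth_eq_iff_index_eq nth_idx nth_mem)
  then show "y \<in> set (pref_list P x) \<and> z \<in> set (pref_list P x) \<and>
      idx (pref_list P x) y < idx (pref_list P x) z"
    using kl by auto
next
  assume "y \<in> set (pref_list P x) \<and> z \<in> set (pref_list P x) \<and>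
      idx (pref_list P x) y < idx (pref_list P x) z"
  then show "prefers P x y z" unfolding prefers_def using nth_idx idx_less_iff by metis
qed

text \<open>Without repetitions, the agents preferred to \<open>y\<close> are exactly the prefix of
  the list before \<open>y\<close>.\<close>

lemma card_preferred:
  assumes "distinct (pref_list P x)" "y \<in> set (pref_list P x)"
  shows "card {z \<in> acceptable P x. prefers P x z y} = idx (pref_list P x) y"
proof -
  have "{z \<in> acceptable P x. prefers P x z y} = set (take (idx (pref_list P x) y) (pref_list P x))"
    using assms by (auto simp: acceptable_def prefers_iff in_set_take_iff)
  then show ?thesis
    using assms(1) idx_le[of "pref_list P x" y] by (simp add: distinct_card)
qed

definition mate :: "nat set set \<Rightarrow> nat \<Rightarrow> nat" where
  "mate M x = (case partner M x of None \<Rightarrow> x | Some y \<Rightarrow> y)"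

lemma wf_pref_list:
  "wf_profile P \<Longrightarrow> x \<in> agents P \<Longrightarrow>
    distinct (pref_list P x) \<and> x \<notin> set (pref_list P x) \<and> set (pref_list P x) \<subseteq> agents P"
  by (auto simp: wf_profile_def acceptable_def)

lemma edges_iff: "{x, y} \<in> edges P \<longleftrightarrow> mutual (prefs_of P) x y"
proof -
  have "{x, y} \<in> edges P \<longleftrightarrow> x \<in> agents P \<and> y \<in> agents P \<and> x \<in> acceptable P y \<and> y \<in> acceptable P x"
    by (auto simp: edges_def doubleton_eq_iff)
  then show ?thesis by (auto simp: mutual_def in_set_prefs_of acceptable_def)
qed

context
  fixes P M
  assumes wf: "wf_profile P" and M: "matching P M"
begin

lemma mutual_matching: "{x, y} \<in> M \<Longrightarrow> mutual (prefs_of P) x y"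
  using M edges_iff by (auto simp: matching_def)

lemma matching_unique: "{x, y} \<in> M \<Longrightarrow> {x, z} \<in> M \<Longrightarrow> y = z"
proof -
  assume xy: "{x, y} \<in> M" and xz: "{x, z} \<in> M"
  have "{x, y} = {x, z}"
  proof (rule ccontr)
    assume "{x, y} \<noteq> {x, z}"
    then have "disjnt {x, y} {x, z}" using M xy xz by (metis matching_def pairwiseD)
    then show False by (simp add: disjnt_def)
  qed
  then show "y = z" by (auto simp: doubleton_eq_iff)
qed

lemma partner_eq_Some: "partner M x = Some y \<longleftrightarrow> {x, y} \<in> M"
  unfolding partner_def using matching_unique by (auto intro!: the_equality) (metis theI)

lemma partner_eq_None: "partner M x = None \<longleftrightarrow> (\<forall>y. {x, y} \<notin> M)"
  by (auto simp: partner_def)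

lemma mate_eq: "mate M x = y \<longleftrightarrow> {x, y} \<in> M \<or> (x = y \<and> (\<forall>z. {x, z} \<notin> M))"
proof (cases "partner M x")
  case None
  then have "mate M x = x" by (simp add: mate_def)
  then show ?thesis using None by (auto simp: partner_eq_None)
next
  case (Some z)
  then have "mate M x = z" "{x, z} \<in> M" by (simp_all add: mate_def flip: partner_eq_Some)
  then show ?thesis using matching_unique[of x z y] by auto
qed

lemma mate_mate: "mate M (mate M x) = x"
  using mate_eq[of x "mate M x"] mate_eq[of "mate M x" x] by (auto simp: insert_commute)

lemma mate_matched: "mate M x \<noteq> x \<Longrightarrow> {x, mate M x} \<in> M"
  using mate_eq[of x "mate M x"] by auto

lemma rank_partner:
  assumes "x \<in> agents P"
  shows "rank P x (partner M x) = idx (prefs_of P x) (mate M x)"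
proof (cases "partner M x")
  case None
  then have "rank P x (partner M x) = length (pref_list P x)"
    using wf_pref_list[OF wf assms] by (simp add: acceptable_def distinct_card)
  then show ?thesis using None wf_pref_list[OF wf assms] assms
    by (simp add: mate_def prefs_of_def idx_notin)
next
  case (Some y)
  then have "y \<in> set (pref_list P x)"
    using mutual_matching[of x y] assms by (auto simp: partner_eq_Some mutual_def prefs_of_def)
  then show ?thesis using Some card_preferred[of P x y] wf_pref_list[OF wf assms] assms
    by (simp add: mate_def prefs_of_def)
qed

lemma egal_cost_eq: "egal_cost P M = cost (agents P) (prefs_of P) (mate M)"
  by (simp add: egal_cost_def cost_def rank_partner)

lemma would_switch_iff:
  assumes "mutual (prefs_of P) x y"
  shows "would_switch P M x y \<longleftrightarrow> idx (prefs_of P x) y < idx (prefs_of P x) (mate M x)"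
proof -
  have x: "x \<in> agents P" and y: "y \<in> set (pref_list P x)"
    using assms by (auto simp: mutual_def in_set_prefs_of)
  note l = wf_pref_list[OF wf x]
  show ?thesis
  proof (cases "partner M x")
    case None
    then show ?thesis using y l x
      by (simp add: would_switch_def mate_def prefs_of_def idx_notin idx_less_iff)
  next
    case (Some z)
    then have "z \<in> set (pref_list P x)"
      using mutual_matching[of x z] x by (auto simp: partner_eq_Some mutual_def prefs_of_def)
    then show ?thesis using Some y l x
      by (simp add: would_switch_def mate_def prefs_of_def prefers_iff)
  qed
qed

lemma stable_iff: "stable P M \<longleftrightarrow> stab (prefs_of P) (mate M)"
proof -
  let ?L = "prefs_of P" and ?\<mu> = "mate M"
  have "(\<exists>x y. blocking P M x y) \<longleftrightarrow>
    \<not> (\<forall>x y. mutual ?L x y \<longrightarrow> idx (?L x) (?\<mu> x) \<le> idx (?L x) y \<or> idx (?L y) (?\<mu> y) \<le> idx (?L y) x)"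
  proof -
    have "blocking P M x y \<longleftrightarrow> mutual ?L x y \<and>
       \<not> (idx (?L x) (?\<mu> x) \<le> idx (?L x) y \<or> idx (?L y) (?\<mu> y) \<le> idx (?L y) x)" for x y
    proof (cases "mutual ?L x y")
      case True
      \<comment> \<open>The two members of an edge of \<open>M\<close> cannot improve strictly by
        each other, so the condition \<open>{x, y} \<notin> M\<close> of a blocking pair comes for
        free.\<close>
      have "?\<mu> x = y" if "{x, y} \<in> M" using that by (simp add: mate_eq)
      then show ?thesis
        using True would_switch_iff[of x y] would_switch_iff[of y x] mutual_sym[of ?L x y]
        by (auto simp: blocking_def edges_iff not_le)
    qed (simp add: blocking_def edges_iff)
    then show ?thesis by blast
  qed
  moreover have "?\<mu> x \<in> set (?L x)" if "?\<mu> x \<noteq> x" for x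
    using mutual_matching[OF mate_matched[OF that]] by (simp add: mutual_def)
  ultimately show ?thesis using M mate_mate by (auto simp: stable_def stab_def)
qed

end

lemma esr_yes_iff:
  assumes wf: "wf_profile P"
  shows "esr_yes (P, \<gamma>) \<longleftrightarrow> solvable (agents P) (prefs_of P) \<gamma>"
proof
  assume "esr_yes (P, \<gamma>)"
  then obtain M where M: "stable P M" "egal_cost P M \<le> \<gamma>" by (auto simp: esr_yes_def)
  then have "matching P M" by (simp add: stable_def)
  then show "solvable (agents P) (prefs_of P) \<gamma>"
    using M stable_iff[OF wf] egal_cost_eq[OF wf] by (auto simp: solvable_def)
next
  assume "solvable (agents P) (prefs_of P) \<gamma>"
  then obtain \<mu> where st: "stab (prefs_of P) \<mu>" and c: "cost (agents P) (prefs_of P) \<mu> \<le> \<gamma>"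
    by (auto simp: solvable_def)
  \<comment> \<open>The orbits of size two of the involution.\<close>
  define M where "M = {{x, \<mu> x} | x. \<mu> x \<noteq> x}"
  have M_iff: "{x, y} \<in> M \<longleftrightarrow> \<mu> x = y \<and> x \<noteq> y" for x y
    using stab_involution[OF st] by (auto simp: M_def doubleton_eq_iff)
  have "disjnt a b" if ab: "a \<in> M" "b \<in> M" "a \<noteq> b" for a b
  proof -
    obtain x y where "a = {x, \<mu> x}" "b = {y, \<mu> y}" using ab by (auto simp: M_def)
    then show ?thesis using ab(3) stab_involution[OF st, of x] stab_involution[OF st, of y]
      by (auto simp: disjnt_def)
  qed
  moreover have "M \<subseteq> edges P"
    using stab_mutual[OF st] edges_iff by (auto simp: M_def)
  ultimately have M: "matching P M" by (auto simp: matching_def pairwise_def)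
  have "mate M = \<mu>"
    using mate_eq[OF wf M] M_iff by (intro ext) metis
  then show "esr_yes (P, \<gamma>)"
    using st c stable_iff[OF wf M] egal_cost_eq[OF wf M] by (auto simp: esr_yes_def intro!: exI[of _ M])
qed

section \<open>Correctness of the kernel\<close>

lemma kernelize_correct:
  assumes W: "proper W" and fixed: "step (W, g) = (W, g)" and k: "kernelize (W, g) = (P', \<gamma>')"
  shows "wf_profile P' \<and> (esr_yes (P', \<gamma>') \<longleftrightarrow> solvable (ids W) (lookup W) (length g)) \<and>
    \<gamma>' \<le> length g \<and> (length P' = 2 \<or> length P' = 2 * length g) \<and>
    (\<forall>i\<in>agents P'. length (pref_list P' i) \<le> length g + 1)"
proof -
  define L where "L = lookup W"
  define S where "S = {x. L x \<noteq> []}"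
  define E where "E = nonempty W"
  define m where "m = length E"
  define D where "D = dummies E g"
  define \<nu> where "\<nu> = number E"
  have cS: "card S = m" using card_nonempty[OF W] by (simp add: S_def L_def m_def E_def)
  have SA: "S \<subseteq> ids W" using lookup_notin by (auto simp: S_def L_def)
  have ll: "loopless L" unfolding L_def by (rule loopless_lookup[OF W])
  have nt: "no_tops L" using step_fixed(2)[OF fixed] head_mutual_iff[OF W] by (simp add: L_def)
  have D: "D = [Suc m..<Suc (2 * length g)]" by (simp only: D_def dummies_eq m_def)
  show ?thesis
  proof (cases "m \<le> 2 * length g")
    case False
    then have k': "P' = [[2], []]" "\<gamma>' = 0" using k by (auto simp: kernelize_def m_def E_def Let_def)
    \<comment> \<open>More than \<open>2 * length g\<close> nonempty lists contradict the first of
      the rank bounds, which agrees with the constant no-instance.\<close>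
    have "\<not> solvable (ids W) L (length g)"
    proof
      assume "solvable (ids W) L (length g)"
      then obtain \<mu> where "stab L \<mu>" "cost (ids W) L \<mu> \<le> length g" by (auto simp: solvable_def)
      then have "card S \<le> 2 * length g"
        by (intro rank_bounds(1)[OF finite_ids SA _ ll nt]) (auto simp: S_def)
      then show False using False cS by simp
    qed
    moreover have "length (pref_list P' i) \<le> length g + 1" if "i \<in> agents P'" for i
      using that by (auto simp: k' agents_def pref_list_def nth_Cons split: nat.split)
    ultimately show ?thesis using esr_no_zero by (simp add: k' L_def esr_instances_def)
  next
    case True
    have trim: "trim W g = W" using step_fixed(3)[OF fixed] True by (simp add: m_def E_def)
    note count = dead_count[OF W step_fixed(1)[OF fixed] _ trim, folded E_def L_def, folded m_def, OF True]
    have P': "P' = map (renumber W D) E @ map (\<lambda>_. []) D" and \<gamma>': "\<gamma>' = length g"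
      using k True by (auto simp: kernelize_def m_def E_def D_def Let_def)
    have lD: "length D = 2 * length g - m" unfolding D length_upt by simp
    have lP: "length P' = 2 * length g" using True by (simp add: P' lD m_def[symmetric])
    have agents: "agents P' = {1..2 * length g}" by (simp add: agents_def lP)
    have dist: "distinct (map fst E)" unfolding E_def by (rule distinct_nonempty[OF W])
    have SE: "S = fst ` set E" unfolding E_def S_def L_def by (rule set_nonempty[OF W, symmetric])
    have \<nu>_nth: "\<nu> (fst (E ! i)) = Suc i" if "i < m" for i
      using number_nth[OF dist, of i] that by (simp add: \<nu>_def m_def)
    have nth: "\<exists>i<m. x = fst (E ! i) \<and> L x = snd (E ! i) \<and> \<nu> x = Suc i" if x: "x \<in> S" for x
    proof -
      obtain i where i: "i < m" "x = fst (E ! i)" using x by (auto simp: SE m_def in_set_conv_nth)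
      then have "E ! i \<in> set W" using nth_mem[of i E] by (auto simp: m_def E_def nonempty_def)
      then have "L x = snd (E ! i)" using lookup_entry[OF W] i by (simp add: L_def)
      then show ?thesis using i \<nu>_nth by auto
    qed
    have inj: "inj_on \<nu> S"
    proof (rule inj_onI)
      fix x y assume "x \<in> S" "y \<in> S" "\<nu> x = \<nu> y"
      then show "x = y" using nth[of x] nth[of y] by auto
    qed
    \<comment> \<open>The survivors fill an initial segment, so the dummies, which start at
      \<open>m + 1\<close>, are new names.\<close>
    have \<nu>S: "\<nu> ` S = {1..m}"
    proof
      show "\<nu> ` S \<subseteq> {1..m}" using nth by force
      show "{1..m} \<subseteq> \<nu> ` S"
      proof
        fix z assume "z \<in> {1..m}"
        then have "z - 1 < m" "Suc (z - 1) = z" by auto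
        then have "z = \<nu> (fst (E ! (z - 1)))" "fst (E ! (z - 1)) \<in> S"
          using \<nu>_nth[of "z - 1"] by (simp_all add: SE m_def)
        then show "z \<in> \<nu> ` S" by (rule image_eqI)
      qed
    qed
    have disj: "\<nu> x \<notin> set D" if "x \<in> S" for x using imageI[OF that, of \<nu>] unfolding \<nu>S D by auto
    let ?L = "prefs_of P'"
    have L': "?L (\<nu> x) = place (\<lambda>y. x \<in> set (L y)) \<nu> (L x) D" if x: "x \<in> S" for x
    proof -
      obtain i where i: "i < m" "x = fst (E ! i)" "L x = snd (E ! i)" "\<nu> x = Suc i" using nth[OF x] by auto
      then have "P' ! i = renumber W D (E ! i)" by (simp add: P' m_def nth_append)
      also have "\<dots> = place (\<lambda>y. x \<in> set (L y)) \<nu> (L x) D"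
        using i by (simp add: renumber_def L_def \<nu>_def E_def)
      finally show ?thesis using i True by (simp add: prefs_of_def agents pref_list_def)
    qed
    have L'_out: "?L z = []" if "z \<notin> \<nu> ` S" for z
    proof (cases "z \<in> agents P'")
      case z: True
      then have "m \<le> z - 1" "z - 1 < m + length D" using that True by (auto simp: \<nu>S agents lD)
      then have "P' ! (z - 1) = []" by (simp add: P' m_def nth_append)
      then show ?thesis by (simp add: prefs_of_def pref_list_def)
    qed (simp add: prefs_of_def)
    have live: "y \<in> S" if "y \<in> set (L x)" "x \<in> set (L y)" for x y using that by (auto simp: S_def)
    have \<nu>_mem: "\<nu> y \<in> set (?L (\<nu> x)) \<longleftrightarrow> mutual L x y" if x: "x \<in> S" and y: "y \<in> S" for x y
    proof
      assume "\<nu> y \<in> set (?L (\<nu> x))"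
      then have "\<nu> y \<in> \<nu> ` {y \<in> set (L x). x \<in> set (L y)}"
        using set_place_subset[of "\<lambda>y. x \<in> set (L y)" \<nu> "L x" D] disj[OF y] L'[OF x] by auto
      then obtain z where z: "z \<in> set (L x)" "x \<in> set (L z)" "\<nu> y = \<nu> z" by auto
      then have "y = z" using inj y live[OF z(1,2)] by (auto dest: inj_onD)
      then show "mutual L x y" using z by (simp add: mutual_def)
    next
      assume "mutual L x y"
      then show "\<nu> y \<in> set (?L (\<nu> x))" unfolding L'[OF x] by (intro place_live) (auto simp: mutual_def)
    qed
    have mut: "mutual ?L (\<nu> x) (\<nu> y) \<longleftrightarrow> mutual L x y" if "x \<in> S" "y \<in> S" for x y
      using \<nu>_mem[OF that] \<nu>_mem[OF that(2,1)] mutual_sym[of L x y] by (auto simp: mutual_def)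
    \<comment> \<open>The dummies suffice, so \<open>place\<close> drops nothing and unmatched
      agents pay the same as before.\<close>
    have len: "length (?L (\<nu> x)) = length (L x)" if "x \<in> S" for x
      unfolding L'[OF that] by (rule length_place) (use count(2)[of x] lD in simp)
    have idx: "idx (?L (\<nu> x)) (\<nu> y) = idx (L x) y" if m: "mutual L x y" for x y
    proof -
      have xy: "x \<in> S" "y \<in> S" using m live by (auto simp: mutual_def)
      show ?thesis unfolding L'[OF xy(1)]
      proof (rule idx_place)
        show "length (filter (\<lambda>z. \<not> x \<in> set (L z)) (L x)) \<le> length D" using count(2)[of x] lD by simp
        show "z = y" if "z \<in> set (L x)" "x \<in> set (L z)" "\<nu> z = \<nu> y" for z
          using inj that(3) live[OF that(1,2)] xy(2) by (auto dest: inj_onD)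
      qed (use m disj[OF xy(2)] in \<open>auto simp: mutual_def\<close>)
    qed
    have ll': "loopless ?L"
      unfolding loopless_def
    proof
      fix z show "z \<notin> set (?L z)"
      proof (cases "z \<in> \<nu> ` S")
        case True
        then show ?thesis using \<nu>_mem ll by (auto simp: mutual_def loopless_def)
      qed (simp add: L'_out)
    qed
    have sub: "set (?L z) \<subseteq> agents P'" and dist': "distinct (?L z)" for z
    proof -
      have "set (?L z) \<subseteq> agents P' \<and> distinct (?L z)"
      proof (cases "z \<in> \<nu> ` S")
        case z: True
        then obtain x where x: "x \<in> S" "z = \<nu> x" by blast
        let ?Q = "{y \<in> set (L x). x \<in> set (L y)}"
        have Q: "?Q \<subseteq> S" using live by auto
        have "set (?L z) \<subseteq> \<nu> ` ?Q \<union> set D" unfolding x(2) L'[OF x(1)] by (rule set_place_subset)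
        also have "\<dots> \<subseteq> \<nu> ` S \<union> set D" using Q by blast
        also have "\<dots> \<subseteq> agents P'" using True unfolding \<nu>S agents D by auto
        finally have "set (?L z) \<subseteq> agents P'" .
        moreover have "distinct (?L z)" unfolding x(2) L'[OF x(1)]
        proof (rule distinct_place)
          show "distinct (L x)" unfolding L_def by (rule lookup_distinct[OF W])
          show "inj_on \<nu> ?Q" using inj Q by (rule inj_on_subset)
          show "\<nu> ` ?Q \<inter> set D = {}" using disj Q by blast
        qed (simp add: D)
        ultimately show ?thesis ..
      qed (simp add: L'_out)
      then show "set (?L z) \<subseteq> agents P'" "distinct (?L z)" by auto
    qed
    have wf: "wf_profile P'"
      unfolding wf_profile_def
    proof (intro conjI ballI)
      show "even (length P')" by (simp add: lP)
      fix i assume i: "i \<in> agents P'"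
      then have eq: "pref_list P' i = ?L i" by (simp add: prefs_of_def)
      show "distinct (pref_list P' i)" unfolding eq by (rule dist')
      show "acceptable P' i \<subseteq> agents P' - {i}"
        using sub[of i] ll' by (auto simp: acceptable_def eq loopless_def)
    qed
    have "solvable (ids W) L (length g) \<longleftrightarrow> solvable (agents P') ?L (length g)"
    proof (rule solvable_rename_iff[OF finite_ids _ SA _ ll ll' inj])
      show "\<nu> ` S \<subseteq> agents P'" using True by (auto simp: \<nu>S agents)
    qed (use L'_out mut idx len in \<open>auto simp: agents S_def\<close>)
    moreover have "length (pref_list P' i) \<le> length g + 1" if i: "i \<in> agents P'" for i
    proof (cases "i \<in> \<nu> ` S")
      case z: True
      then obtain x where x: "x \<in> S" "i = \<nu> x" by blast
      \<comment> \<open>A positive \<open>m\<close> takes at least one unit off the budget, which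
        turns the bound with \<open>+ 2\<close> into \<open>length g + 1\<close>.\<close>
      then have "m > 0" using nth by force
      moreover have "length (pref_list P' i) = length (L x)"
        using len[OF x(1)] i x by (simp add: prefs_of_def)
      ultimately show ?thesis using count(1)[of x] True by simp
    next
      case False
      then show ?thesis using L'_out[OF False] i by (simp add: prefs_of_def)
    qed
    ultimately show ?thesis using wf esr_yes_iff[OF wf] lP by (simp add: \<gamma>' L_def)
  qed
qed

text \<open>No matching costs more than the total length of the lists, so the bound may be capped there; this
  makes its unary representation affordable.\<close>

definition cap :: "profile \<Rightarrow> nat \<Rightarrow> unit list" where
  "cap P \<gamma> = snd (fold (\<lambda>_ st. if fst st = \<gamma> then st else (Suc (fst st), () # snd st)) (concat P) (0, []))"

text \<open>The list \<open>concat (fst I)\<close> serves as a clock only: its length is the initial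
  value of \<open>total\<close>, so the iteration ends in a fixed point.\<close>

definition kernel :: "esr_instance \<Rightarrow> esr_instance" where
  "kernel I = kernelize (fold (\<lambda>_. step) (concat (fst I)) (enum (fst I), cap (fst I) (snd I)))"

lemma fold_const: "fold (\<lambda>_. f) xs x = (f ^^ length xs) x"
  by (induction xs arbitrary: x) (auto simp: funpow_swap1)

lemma fold_cap:
  "c \<le> \<gamma> \<Longrightarrow> fold (\<lambda>_ st. if fst st = \<gamma> then st else (Suc (fst st), () # snd st)) xs (c, replicate c ()) =
    (min \<gamma> (c + length xs), replicate (min \<gamma> (c + length xs)) ())"
proof (induction xs arbitrary: c)
  case (Cons x xs)
  then show ?case using Cons.IH[of "Suc c"] Cons.IH[of c] by (cases "c = \<gamma>") auto
qed simp

lemma length_cap: "length (cap P \<gamma>) = min \<gamma> (length (concat P))"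
  unfolding cap_def using fold_cap[of 0 \<gamma> "concat P"] by simp

lemma solvable_cap:
  assumes "proper W"
  shows "solvable (ids W) (lookup W) (min \<gamma> (total W)) \<longleftrightarrow> solvable (ids W) (lookup W) \<gamma>"
proof -
  have "cost (ids W) (lookup W) \<mu> \<le> total W" for \<mu>
  proof -
    have "cost (ids W) (lookup W) \<mu> \<le> (\<Sum>x\<in>ids W. length (lookup W x))"
      unfolding cost_def by (intro sum_mono idx_le)
    also have "\<dots> = (\<Sum>x\<leftarrow>map fst W. length (lookup W x))"
      using assms by (simp add: proper_def ids_def sum_list_distinct_conv_sum_set del: map_map flip: set_map)
    also have "\<dots> = total W"
      unfolding total_def map_map comp_def
      by (intro arg_cong[where f = sum_list] map_cong) (auto simp: lookup_entry[OF assms])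
    finally show ?thesis .
  qed
  then show ?thesis by (auto simp: solvable_def)
qed

lemma kernel_correct:
  assumes P: "wf_profile P" and k: "kernel (P, \<gamma>) = (P', \<gamma>')"
  shows "wf_profile P'" and "esr_yes (P', \<gamma>') \<longleftrightarrow> esr_yes (P, \<gamma>)"
    and "\<gamma>' \<le> \<gamma>" and "length P' \<le> max 2 (2 * \<gamma>)"
    and "i \<in> agents P' \<Longrightarrow> length (pref_list P' i) \<le> \<gamma> + 1"
proof -
  define W0 where "W0 = enum P"
  define g0 where "g0 = cap P \<gamma>"
  define n where "n = length (concat P)"
  have W0: "proper W0" unfolding W0_def by (rule proper_enum[OF P])
  have g0: "length g0 = min \<gamma> (total W0)" by (simp add: g0_def W0_def length_cap total_enum)
  obtain W g where Wg: "(step ^^ n) (W0, g0) = (W, g)" by (cases "(step ^^ n) (W0, g0)")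
  have fixed: "step (W, g) = (W, g)"
    using step_funpow_fixed[of "(W0, g0)" n] by (simp add: Wg) (simp add: W0_def n_def total_enum)
  have eqv: "equivalent (W0, g0) (W, g)"
    using equivalent_funpow[of "(W0, g0)" n] W0 by (simp add: Wg)
  have "kernelize (W, g) = (P', \<gamma>')"
    using k by (simp add: kernel_def fold_const Wg flip: W0_def g0_def n_def)
  note res = kernelize_correct[OF _ fixed this]
  have "solvable (ids W) (lookup W) (length g) \<longleftrightarrow> esr_yes (P, \<gamma>)"
    using eqv solvable_cap[OF W0, of \<gamma>] esr_yes_iff[OF P]
    by (simp add: equivalent_def g0) (simp add: W0_def ids_enum lookup_enum)
  then show "wf_profile P'" and "esr_yes (P', \<gamma>') \<longleftrightarrow> esr_yes (P, \<gamma>)"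
    and "\<gamma>' \<le> \<gamma>" and "length P' \<le> max 2 (2 * \<gamma>)"
    and "i \<in> agents P' \<Longrightarrow> length (pref_list P' i) \<le> \<gamma> + 1"
    using res eqv g0 by (fastforce simp: equivalent_def)+
qed

section \<open>Polynomial-time functions\<close>

text \<open>A class fixes one encoding per type, so that \<open>ptime\<close> can be stated without
  mentioning encodings. The instances are chosen to agree with \<open>enc_instance\<close>.\<close>

class enc = fixes enc :: "'a \<Rightarrow> tree"

instantiation unit :: enc begin
definition enc_unit :: "unit \<Rightarrow> tree" where "enc_unit _ = Leaf"
instance ..
end

instantiation bool :: enc begin
definition enc_bool_inst: "enc = enc_bool"
instance ..
end

instantiation nat :: enc begin
definition enc_nat_inst: "enc = enc_nat"
instance ..
end

instantiation list :: (enc) enc begin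
definition enc_list_inst: "enc = enc_list enc"
instance ..
end

instantiation prod :: (enc, enc) enc begin
definition enc_prod_inst: "enc p = Node (enc (fst p)) (enc (snd p))"
instance ..
end

abbreviation esize :: "'a::enc \<Rightarrow> nat" where "esize x \<equiv> size (enc x)"


text \<open>A program that works above an arbitrary base register \<open>N\<close> and leaves all higher registers clean can
  be used as a subroutine without renaming variables.  The bound on the size of the value in \<open>ptime\<close> is
  not implied by the running time, because shared subtrees can make a value exponentially large.\<close>

definition computes :: "com \<Rightarrow> nat \<Rightarrow> ('a::enc \<Rightarrow> 'b::enc) \<Rightarrow> nat poly \<Rightarrow> bool" where
  "computes c N f p \<longleftrightarrow> (\<forall>x s. s N = enc x \<longrightarrow> (\<forall>i>N. s i = Leaf) \<longrightarrow>
     (\<exists>t \<le> poly p (esize x). exec c s t (s(N := enc (f x)))))"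

definition ptime :: "('a::enc \<Rightarrow> 'b::enc) \<Rightarrow> bool" where
  "ptime f \<longleftrightarrow> (\<exists>p. \<forall>N. \<exists>c. computes c N f p) \<and>
     (\<exists>q :: nat poly. \<forall>x. esize (f x) \<le> poly q (esize x))"

text \<open>The coefficients are natural numbers, hence nonnegative.\<close>

lemma poly_mono_nat: "m \<le> n \<Longrightarrow> poly p m \<le> poly p (n :: nat)"
  by (induction p) (auto intro!: add_mono mult_mono)

lemma computesI:
  assumes "\<And>x s. s N = enc x \<Longrightarrow> (\<forall>i>N. s i = Leaf) \<Longrightarrow>
     \<exists>t \<le> poly p (esize x). exec c s t (s(N := enc (f x)))"
  shows "computes c N f p"
  using assms unfolding computes_def by blast

lemma computesE:
  assumes "computes c N f p" "s N = enc x" "\<And>i. i > N \<Longrightarrow> s i = Leaf"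
  obtains t where "t \<le> poly p (esize x)" "exec c s t (s(N := enc (f x)))"
  using assms unfolding computes_def by blast

lemma exec_AssignI: "s' = s(x := eval_exp e s) \<Longrightarrow> t = 1 + cost_exp e \<Longrightarrow> exec (Assign x e) s t s'"
  using exec.Assign by simp

lemma ptimeI:
  assumes "\<And>N. \<exists>c. computes c N f p" and "\<And>x. esize (f x) \<le> poly q (esize x)"
  shows "ptime f"
  using assms unfolding ptime_def by blast

lemma ptimeE:
  assumes "ptime f"
  obtains p q where "\<And>N. \<exists>c. computes c N f p" "\<And>x. esize (f x) \<le> poly q (esize x)"
  using assms unfolding ptime_def by blast

section \<open>Expressions, composition, pairing and branching\<close>

lemma ptime_expI:
  fixes f :: "'a::enc \<Rightarrow> 'b::enc"
  assumes e: "\<And>N x s. s N = enc x \<Longrightarrow> eval_exp (e N) s = enc (f x)"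
    and k: "\<And>N. 1 + cost_exp (e N) \<le> k"
    and q: "\<And>x. esize (f x) \<le> poly q (esize x)"
  shows "ptime f"
proof (rule ptimeI[where p = "[:k:]"])
  fix N
  have "computes (Assign N (e N)) N f [:k:]"
  proof (rule computesI)
    fix x :: 'a and s :: state
    assume s: "s N = enc x"
    show "\<exists>t \<le> poly [:k:] (esize x). exec (Assign N (e N)) s t (s(N := enc (f x)))"
      using exec.Assign[of N "e N" s] k[of N] e[of s N x, OF s] by auto
  qed
  then show "\<exists>c. computes c N f [:k:]" ..
qed (rule q)

lemma ptime_id: "ptime (\<lambda>x. x)"
  by (rule ptime_expI[where e = Var and k = 2 and q = "[:0,1:]"]) auto

lemma ptime_const: "ptime (\<lambda>x. c)"
proof -
  \<comment> \<open>The expression that rebuilds a given tree from leaves.\<close>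
  define ex where "ex = rec_tree LeafE (\<lambda>_ _. NodeE)"
  have "eval_exp (ex t) s = t" for t s
    by (induction t) (auto simp: ex_def)
  then show ?thesis
    by (intro ptime_expI[where e = "\<lambda>_. ex (enc c)" and k = "1 + cost_exp (ex (enc c))"
          and q = "[:esize c:]"]) auto
qed

text \<open>A change of type that leaves the tree unchanged needs no new program: a nonempty list is
  encoded like the pair of its head and tail, a number like the list of its bits.\<close>

lemma ptime_recode:
  assumes "\<And>x. enc (g x) = enc (f x)" and "ptime f"
  shows "ptime g"
  using assms by (simp add: ptime_def computes_def)

text \<open>The running time of \<open>g\<close> is measured in the size of \<open>f x\<close>; this
  is where the bound on value sizes in \<open>ptime\<close> is needed.\<close>

lemma ptime_comp:
  fixes f :: "'a::enc \<Rightarrow> 'b::enc"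
  assumes f: "ptime f" and g: "ptime g"
  shows "ptime (\<lambda>x. g (f x))"
proof -
  obtain p a where p: "\<And>N. \<exists>c. computes c N f p" and a: "\<And>x. esize (f x) \<le> poly a (esize x)"
    using f by (rule ptimeE) blast
  obtain q b where q: "\<And>N. \<exists>c. computes c N g q" and b: "\<And>x. esize (g x) \<le> poly b (esize x)"
    using g by (rule ptimeE) blast
  show ?thesis
  proof (rule ptimeI[where p = "p + pcompose q a" and q = "pcompose b a"])
    fix N
    obtain c d where c: "computes c N f p" and d: "computes d N g q" using p q by meson
    have "computes (Seq c d) N (\<lambda>x. g (f x)) (p + pcompose q a)"
    proof (rule computesI)
      fix x :: 'a and s :: state
      assume s: "s N = enc x" "\<forall>i>N. s i = Leaf"
      obtain t where t: "t \<le> poly p (esize x)" "exec c s t (s(N := enc (f x)))"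
        using computesE[OF c, of s x] s by blast
      obtain u where u: "u \<le> poly q (esize (f x))"
          "exec d (s(N := enc (f x))) u (s(N := enc (f x), N := enc (g (f x))))"
        using computesE[OF d, of "s(N := enc (f x))" "f x"] s(2) by auto
      have "u \<le> poly q (poly a (esize x))"
        using u(1) poly_mono_nat[OF a[of x], of q] by linarith
      then show "\<exists>t \<le> poly (p + pcompose q a) (esize x). exec (Seq c d) s t (s(N := enc (g (f x))))"
        using exec.Seq[OF t(2) u(2)] t(1)
        by (intro exI[of _ "t + u"]) (auto simp: poly_pcompose)
    qed
    then show "\<exists>c. computes c N (\<lambda>x. g (f x)) (p + pcompose q a)" ..
  next
    fix x :: 'a show "esize (g (f x)) \<le> poly (pcompose b a) (esize x)"
      using b[of "f x"] poly_mono_nat[OF a[of x], of b] by (simp add: poly_pcompose)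
  qed
qed

lemma ptime_fst: "ptime f \<Longrightarrow> ptime (\<lambda>x. fst (f x))"
  by (erule ptime_comp, rule ptime_expI[where e = "\<lambda>N. LeftE (Var N)" and k = 3 and q = "[:0,1:]"])
    (auto simp: enc_prod_inst)

lemma ptime_snd: "ptime f \<Longrightarrow> ptime (\<lambda>x. snd (f x))"
  by (erule ptime_comp, rule ptime_expI[where e = "\<lambda>N. RightE (Var N)" and k = 3 and q = "[:0,1:]"])
    (auto simp: enc_prod_inst)

text \<open>The input stays in register \<open>N\<close> while the components are computed in the
  two registers above it, which are cleaned afterwards.\<close>

lemma ptime_Pair:
  fixes f :: "'a::enc \<Rightarrow> 'b::enc"
  assumes f: "ptime f" and g: "ptime g"
  shows "ptime (\<lambda>x. (f x, g x))"
proof -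
  obtain p a where p: "\<And>N. \<exists>c. computes c N f p" and a: "\<And>x. esize (f x) \<le> poly a (esize x)"
    using f by (rule ptimeE) blast
  obtain q b where q: "\<And>N. \<exists>c. computes c N g q" and b: "\<And>x. esize (g x) \<le> poly b (esize x)"
    using g by (rule ptimeE) blast
  show ?thesis
  \<comment> \<open>The five assignments cost 2, 2, 4, 2 and 2.\<close>
  proof (rule ptimeI[where p = "p + q + [:12:]" and q = "[:1:] + a + b"])
    fix N
    obtain c d where c: "computes c (N + 1) f p" and d: "computes d (N + 2) g q" using p q by meson
    define prog where "prog =
      Seq (Assign (N + 1) (Var N)) (Seq c (Seq (Assign (N + 2) (Var N)) (Seq d
       (Seq (Assign N (NodeE (Var (N + 1)) (Var (N + 2))))
       (Seq (Assign (N + 1) LeafE) (Assign (N + 2) LeafE))))))"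
    have "computes prog N (\<lambda>x. (f x, g x)) (p + q + [:12:])"
    proof (rule computesI)
      fix x :: 'a and s :: state
      assume s: "s N = enc x" "\<forall>i>N. s i = Leaf"
      let ?s1 = "s(N + 1 := enc x)"
      let ?s2 = "s(N + 1 := enc (f x))"
      let ?s3 = "s(N + 1 := enc (f x), N + 2 := enc x)"
      let ?s4 = "s(N + 1 := enc (f x), N + 2 := enc (g x))"
      let ?s5 = "s(N + 1 := enc (f x), N + 2 := enc (g x), N := enc (f x, g x))"
      let ?s6 = "s(N + 2 := enc (g x), N := enc (f x, g x))"
      obtain t where t: "t \<le> poly p (esize x)" "exec c ?s1 t (?s1(N + 1 := enc (f x)))"
        using computesE[OF c, of ?s1 x] s by auto
      obtain u where u: "u \<le> poly q (esize x)" "exec d ?s3 u (?s3(N + 2 := enc (g x)))"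
        using computesE[OF d, of ?s3 x] s by auto
      have 1: "exec (Assign (N + 1) (Var N)) s 2 ?s1"
        by (rule exec_AssignI) (use s in auto)
      have 2: "exec c ?s1 t ?s2" using t(2) by simp
      have 3: "exec (Assign (N + 2) (Var N)) ?s2 2 ?s3"
        by (rule exec_AssignI) (use s in auto)
      have 4: "exec d ?s3 u ?s4" using u(2) by simp
      have 5: "exec (Assign N (NodeE (Var (N + 1)) (Var (N + 2)))) ?s4 4 ?s5"
        by (rule exec_AssignI) (auto simp: enc_prod_inst)
      have 6: "exec (Assign (N + 1) LeafE) ?s5 2 ?s6"
        by (rule exec_AssignI) (use s in auto)
      have 7: "exec (Assign (N + 2) LeafE) ?s6 2 (s(N := enc (f x, g x)))"
        by (rule exec_AssignI) (use s in auto)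
      show "\<exists>t \<le> poly (p + q + [:12:]) (esize x). exec prog s t (s(N := enc (f x, g x)))"
        unfolding prog_def
        by (rule exI, rule conjI[rotated], (rule exec.Seq 1 2 3 4 5 6 7)+) (use t u in simp)
    qed
    then show "\<exists>c. computes c N (\<lambda>x. (f x, g x)) (p + q + [:12:])" ..
  next
    fix x :: 'a show "esize (f x, g x) \<le> poly ([:1:] + a + b) (esize x)"
      using a[of x] b[of x] by (simp add: enc_prod_inst)
  qed
qed

lemma ptime_if:
  fixes f :: "'a::enc \<Rightarrow> 'b::enc"
  assumes b: "ptime b" and f: "ptime f" and g: "ptime g"
  shows "ptime (\<lambda>x. if b x then f x else g x)"
proof -
  obtain r where r: "\<And>N. \<exists>c. computes c N b r"
    using b by (rule ptimeE) blast
  obtain p k where p: "\<And>N. \<exists>c. computes c N f p" and k: "\<And>x. esize (f x) \<le> poly k (esize x)"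
    using f by (rule ptimeE) blast
  obtain q l where q: "\<And>N. \<exists>c. computes c N g q" and l: "\<And>x. esize (g x) \<le> poly l (esize x)"
    using g by (rule ptimeE) blast
  show ?thesis
  \<comment> \<open>Copying the input, testing the condition and cleaning its register cost 2
    each.\<close>
  proof (rule ptimeI[where p = "r + p + q + [:6:]" and q = "k + l"])
    fix N
    obtain e c d where e: "computes e (N + 1) b r" and c: "computes c N f p"
      and d: "computes d N g q" using r p q by meson
    define prog where "prog = Seq (Assign (N + 1) (Var N)) (Seq e
       (If (Var (N + 1)) (Seq (Assign (N + 1) LeafE) c) (Seq (Assign (N + 1) LeafE) d)))"
    have "computes prog N (\<lambda>x. if b x then f x else g x) (r + p + q + [:6:])"
    proof (rule computesI)
      fix x :: 'a and s :: state
      assume s: "s N = enc x" "\<forall>i>N. s i = Leaf"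
      let ?s1 = "s(N + 1 := enc x)"
      let ?s2 = "s(N + 1 := enc (b x))"
      obtain t where t: "t \<le> poly r (esize x)" "exec e ?s1 t (?s1(N + 1 := enc (b x)))"
        using computesE[OF e, of ?s1 x] s by auto
      obtain u where u: "u \<le> poly p (esize x)" "exec c s u (s(N := enc (f x)))"
        using computesE[OF c, of s x] s by auto
      obtain v where v: "v \<le> poly q (esize x)" "exec d s v (s(N := enc (g x)))"
        using computesE[OF d, of s x] s by auto
      have 1: "exec (Assign (N + 1) (Var N)) s 2 ?s1"
        by (rule exec_AssignI) (use s in auto)
      have 2: "exec e ?s1 t ?s2" using t(2) by simp
      have 3: "exec (Assign (N + 1) LeafE) ?s2 2 s"
        by (rule exec_AssignI) (use s in auto)
      have 4: "?s2 (N + 1) = Leaf \<longleftrightarrow> \<not> b x" by (cases "b x") (auto simp: enc_bool_inst)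
      show "\<exists>t \<le> poly (r + p + q + [:6:]) (esize x).
          exec prog s t (s(N := enc (if b x then f x else g x)))"
      proof (cases "b x")
        case True
        have "exec prog s (2 + (t + (1 + cost_exp (Var (N + 1)) + (2 + u)))) (s(N := enc (f x)))"
          unfolding prog_def
          by (rule exec.Seq[OF 1 exec.Seq[OF 2 exec.IfTrue[OF _ exec.Seq[OF 3 u(2)]]]])
            (use True 4 in simp)
        then show ?thesis using True t(1) u(1)
          by (intro exI[of _ "2 + (t + (1 + cost_exp (Var (N + 1)) + (2 + u)))"]) simp
      next
        case False
        have "exec prog s (2 + (t + (1 + cost_exp (Var (N + 1)) + (2 + v)))) (s(N := enc (g x)))"
          unfolding prog_def
          by (rule exec.Seq[OF 1 exec.Seq[OF 2 exec.IfFalse[OF _ exec.Seq[OF 3 v(2)]]]])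
            (use False 4 in simp)
        then show ?thesis using False t(1) v(1)
          by (intro exI[of _ "2 + (t + (1 + cost_exp (Var (N + 1)) + (2 + v)))"]) simp
      qed
    qed
    then show "\<exists>c. computes c N (\<lambda>x. if b x then f x else g x) (r + p + q + [:6:])" ..
  next
    fix x :: 'a show "esize (if b x then f x else g x) \<le> poly (k + l) (esize x)"
      using k[of x] l[of x] by simp
  qed
qed


section \<open>Sizes of encodings and iteration over lists\<close>

lemma esize_Cons: "esize (y # ys) = 1 + esize y + esize ys"
  by (simp add: enc_list_inst)

lemma esize_Nil: "esize [] = 0"
  by (simp add: enc_list_inst)

lemma esize_Pair: "esize (x, y) = 1 + esize x + esize y"
  by (simp add: enc_prod_inst)

lemma length_le_esize: "length ys \<le> esize ys"
  by (induction ys) (auto simp: esize_Nil esize_Cons)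

lemma esize_member: "y \<in> set ys \<Longrightarrow> esize y < esize ys"
  by (induction ys) (auto simp: esize_Cons)

text \<open>Polynomial time for a single round does not bound the iteration, since the accumulator
  might be squared in each round. Hence all intermediate values, one for each prefix
  \<open>ys\<close>, must be bounded by one polynomial in the size of the input.\<close>

lemma ptime_fold:
  fixes f :: "'a::enc \<Rightarrow> 'b::enc \<Rightarrow> 'c::enc \<Rightarrow> 'c"
  assumes f: "ptime (\<lambda>p. f (fst p) (fst (snd p)) (snd (snd p)))"
    and xs: "ptime xs" and i: "ptime i"
    and bound: "\<And>x ys zs. xs x = ys @ zs \<Longrightarrow> esize (fold (f x) ys (i x)) \<le> poly B (esize x)"
  shows "ptime (\<lambda>x. fold (f x) (xs x) (i x))"
proof -
  define F where "F = (\<lambda>p. f (fst p) (fst (snd p)) (snd (snd p)))"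
  obtain r where r: "\<And>N. \<exists>c. computes c N F r"
    using f unfolding F_def by (rule ptimeE) blast
  obtain p k where p: "\<And>N. \<exists>c. computes c N xs p" and k: "\<And>x. esize (xs x) \<le> poly k (esize x)"
    using xs by (rule ptimeE) blast
  obtain q where q: "\<And>N. \<exists>c. computes c N i q"
    using i by (rule ptimeE) blast
  \<comment> \<open>The cost of a round: 14 for the four assignments of the body, 2 for the loop
    test, and a call of \<open>f\<close> on the triple of input, list element and accumulator, whose
    two pair nodes give the coefficient 2.\<close>
  define K where "K = [:16:] + pcompose r ([:2, 1:] + k + B)"
  \<comment> \<open>The constant 12 covers the assignments outside the loop and the final
    test.\<close>
  define T where "T = p + q + [:12:] + k * K"
  show ?thesis
  proof (rule ptimeI[where p = T and q = B])
    fix N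
    obtain e c d where e: "computes e (N + 3) F r" and c: "computes c (N + 1) xs p"
      and d: "computes d (N + 2) i q" using r p q by meson
    define body where "body =
       Seq (Assign (N + 3) (NodeE (Var N) (NodeE (LeftE (Var (N + 1))) (Var (N + 2)))))
       (Seq e (Seq (Assign (N + 2) (Var (N + 3))) (Seq (Assign (N + 3) LeafE)
       (Assign (N + 1) (RightE (Var (N + 1)))))))"
    define prog where "prog =
       Seq (Assign (N + 1) (Var N)) (Seq c (Seq (Assign (N + 2) (Var N)) (Seq d
       (Seq (While (Var (N + 1)) body)
       (Seq (Assign N (Var (N + 2))) (Assign (N + 2) LeafE))))))"
    have "computes prog N (\<lambda>x. fold (f x) (xs x) (i x)) T"
    proof (rule computesI)
      fix x :: 'a and s :: state
      assume s: "s N = enc x" "\<forall>i>N. s i = Leaf"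
      \<comment> \<open>The loop state: remaining list and accumulator, with the input untouched in
        register \<open>N\<close>.\<close>
      define S where "S = (\<lambda>(l :: 'b list) (acc :: 'c). s(N + 1 := enc l, N + 2 := enc acc))"
      define tb where "tb = poly K (esize x)"
      have body: "\<exists>t \<le> tb - 2. exec body (S (y # ys) acc) t (S ys (f x y acc))"
        if y: "y \<in> set (xs x)" and acc: "esize acc \<le> poly B (esize x)" for y ys acc
      proof -
        let ?p = "(x, y, acc)"
        let ?s1 = "(S (y # ys) acc)(N + 3 := enc ?p)"
        let ?s2 = "(S (y # ys) acc)(N + 3 := enc (f x y acc))"
        let ?s3 = "(S (y # ys) (f x y acc))(N + 3 := enc (f x y acc))"
        let ?s4 = "S (y # ys) (f x y acc)"
        obtain t where t: "t \<le> poly r (esize ?p)" "exec e ?s1 t (?s1(N + 3 := enc (F ?p)))"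
          using computesE[OF e, of ?s1 ?p] s by (auto simp: S_def)
        have 1: "exec (Assign (N + 3) (NodeE (Var N) (NodeE (LeftE (Var (N + 1))) (Var (N + 2)))))
            (S (y # ys) acc) 7 ?s1"
          by (rule exec_AssignI) (use s in \<open>auto simp: S_def enc_prod_inst enc_list_inst\<close>)
        have 2: "exec e ?s1 t ?s2" using t(2) by (simp add: F_def)
        have 3: "exec (Assign (N + 2) (Var (N + 3))) ?s2 2 ?s3"
          by (rule exec_AssignI) (auto simp: S_def)
        have 4: "exec (Assign (N + 3) LeafE) ?s3 2 ?s4"
          by (rule exec_AssignI) (use s in \<open>auto simp: S_def\<close>)
        have 5: "exec (Assign (N + 1) (RightE (Var (N + 1)))) ?s4 3 (S ys (f x y acc))"
          by (rule exec_AssignI) (auto simp: S_def enc_list_inst)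
        have "esize ?p \<le> poly ([:2, 1:] + k + B) (esize x)"
          using acc k[of x] esize_member[OF y] by (simp add: esize_Pair)
        then have "t \<le> poly r (poly ([:2, 1:] + k + B) (esize x))"
          using t(1) poly_mono_nat order_trans by blast
        then have "7 + (t + (2 + (2 + 3))) \<le> tb - 2"
          by (simp add: tb_def K_def poly_pcompose)
        then show ?thesis unfolding body_def
          using exec.Seq[OF 1 exec.Seq[OF 2 exec.Seq[OF 3 exec.Seq[OF 4 5]]]] by blast
      qed
      have loop: "\<exists>t \<le> 2 + length zs * tb.
          exec (While (Var (N + 1)) body) (S zs (fold (f x) ys (i x))) t
            (S [] (fold (f x) (xs x) (i x)))"
        if "xs x = ys @ zs" for ys zs
        using that
      proof (induction zs arbitrary: ys)
        case Nil
        have "exec (While (Var (N + 1)) body) (S [] (fold (f x) ys (i x)))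
            (1 + cost_exp (Var (N + 1))) (S [] (fold (f x) ys (i x)))"
          by (rule exec.WhileFalse) (simp add: S_def enc_list_inst)
        moreover have "1 + cost_exp (Var (N + 1)) \<le> 2 + length ([] :: 'b list) * tb" by simp
        ultimately show ?case using Nil by (metis append_Nil2)
      next
        case (Cons z zs)
        obtain t where t: "t \<le> 2 + length zs * tb"
          "exec (While (Var (N + 1)) body) (S zs (fold (f x) (ys @ [z]) (i x))) t
            (S [] (fold (f x) (xs x) (i x)))"
          using Cons.IH[of "ys @ [z]"] Cons.prems by auto
        obtain u where u: "u \<le> tb - 2" "exec body (S (z # zs) (fold (f x) ys (i x))) u
            (S zs (fold (f x) (ys @ [z]) (i x)))"
          using body[of z "fold (f x) ys (i x)" zs] bound[OF Cons.prems] Cons.prems by auto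
        have "exec (While (Var (N + 1)) body) (S (z # zs) (fold (f x) ys (i x)))
            (1 + cost_exp (Var (N + 1)) + u + t) (S [] (fold (f x) (xs x) (i x)))"
          by (rule exec.WhileTrue[OF _ u(2) t(2)]) (simp add: S_def enc_list_inst)
        moreover have "1 + cost_exp (Var (N + 1)) + u + t \<le> 2 + length (z # zs) * tb"
        proof -
          have "tb \<ge> 2" by (simp add: tb_def K_def)
          then show ?thesis using t(1) u(1) by simp
        qed
        ultimately show ?case by blast
      qed
      let ?s1 = "s(N + 1 := enc x)"
      let ?s2 = "s(N + 1 := enc (xs x))"
      let ?s3 = "s(N + 1 := enc (xs x), N + 2 := enc x)"
      let ?res = "fold (f x) (xs x) (i x)"
      obtain t where t: "t \<le> poly p (esize x)" "exec c ?s1 t (?s1(N + 1 := enc (xs x)))"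
        using computesE[OF c, of ?s1 x] s by auto
      obtain u where u: "u \<le> poly q (esize x)" "exec d ?s3 u (?s3(N + 2 := enc (i x)))"
        using computesE[OF d, of ?s3 x] s by auto
      obtain v where v: "v \<le> 2 + length (xs x) * tb"
          "exec (While (Var (N + 1)) body) (S (xs x) (i x)) v (S [] ?res)"
        using loop[of "[]" "xs x"] by auto
      have 1: "exec (Assign (N + 1) (Var N)) s 2 ?s1"
        by (rule exec_AssignI) (use s in auto)
      have 2: "exec c ?s1 t ?s2" using t(2) by simp
      have 3: "exec (Assign (N + 2) (Var N)) ?s2 2 ?s3"
        by (rule exec_AssignI) (use s in auto)
      have 4: "exec d ?s3 u (S (xs x) (i x))" using u(2) by (simp add: S_def)
      have 5: "exec (Assign N (Var (N + 2))) (S [] ?res) 2 ((S [] ?res)(N := enc ?res))"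
        by (rule exec_AssignI) (auto simp: S_def)
      have 6: "exec (Assign (N + 2) LeafE) ((S [] ?res)(N := enc ?res)) 2 (s(N := enc ?res))"
        by (rule exec_AssignI) (use s in \<open>auto simp: S_def enc_list_inst\<close>)
      have "length (xs x) \<le> poly k (esize x)"
        using length_le_esize[of "xs x"] k[of x] by linarith
      then have "length (xs x) * tb \<le> poly k (esize x) * tb" by (rule mult_le_mono1)
      moreover have "poly T (esize x) =
          poly p (esize x) + poly q (esize x) + 12 + poly k (esize x) * tb"
        by (simp add: T_def tb_def)
      ultimately have "2 + (t + (2 + (u + (v + (2 + 2))))) \<le> poly T (esize x)"
        using t(1) u(1) v(1) by linarith
      then show "\<exists>t \<le> poly T (esize x). exec prog s t (s(N := enc ?res))"
        unfolding prog_def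
        using exec.Seq[OF 1 exec.Seq[OF 2 exec.Seq[OF 3 exec.Seq[OF 4 exec.Seq[OF v(2)
          exec.Seq[OF 5 6]]]]]] by blast
    qed
    then show "\<exists>c. computes c N (\<lambda>x. fold (f x) (xs x) (i x)) T" ..
  next
    fix x show "esize (fold (f x) (xs x) (i x)) \<le> poly B (esize x)"
      using bound[of x "xs x" "[]"] by simp
  qed
qed

text \<open>If each round adds only an amount that depends on the input and not on the accumulator,
  the growth is at most the number of rounds times this amount.\<close>

lemma ptime_fold_additive:
  fixes f :: "'a::enc \<Rightarrow> 'b::enc \<Rightarrow> 'c::enc \<Rightarrow> 'c"
  assumes f: "ptime (\<lambda>p. f (fst p) (fst (snd p)) (snd (snd p)))"
    and xs: "ptime xs" and i: "ptime i"
    and step: "\<And>x y acc. y \<in> set (xs x) \<Longrightarrow> esize (f x y acc) \<le> esize acc + poly r (esize x)"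
  shows "ptime (\<lambda>x. fold (f x) (xs x) (i x))"
proof -
  obtain k where k: "\<And>x. esize (xs x) \<le> poly k (esize x)"
    using xs by (rule ptimeE) blast
  obtain l where l: "\<And>x. esize (i x) \<le> poly l (esize x)"
    using i by (rule ptimeE) blast
  have fold: "esize (fold (f x) ys a) \<le> esize a + length ys * poly r (esize x)"
    if "set ys \<subseteq> set (xs x)" for x ys a
    using that
  proof (induction ys arbitrary: a)
    case (Cons y ys)
    have "esize (fold (f x) ys (f x y a)) \<le> esize (f x y a) + length ys * poly r (esize x)"
      using Cons by auto
    moreover have "esize (f x y a) \<le> esize a + poly r (esize x)"
      using step Cons.prems by simp
    ultimately show ?case by (simp add: algebra_simps)
  qed simp
  show ?thesis
  proof (rule ptime_fold[OF f xs i, where B = "l + k * r"])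
    fix x ys zs assume eq: "xs x = ys @ zs"
    have "length ys \<le> poly k (esize x)"
      using length_le_esize[of "xs x"] k[of x] eq by simp
    then have "length ys * poly r (esize x) \<le> poly k (esize x) * poly r (esize x)"
      by (rule mult_le_mono1)
    moreover have "esize (fold (f x) ys (i x)) \<le> esize (i x) + length ys * poly r (esize x)"
      using eq by (intro fold) auto
    ultimately show "esize (fold (f x) ys (i x)) \<le> poly (l + k * r) (esize x)"
      using l[of x] unfolding poly_add poly_mult by linarith
  qed
qed

lemma ptime_Cons: "ptime f \<Longrightarrow> ptime g \<Longrightarrow> ptime (\<lambda>x. f x # g x)"
  by (drule (1) ptime_Pair, erule ptime_recode[rotated]) (simp add: enc_list_inst enc_prod_inst)

text \<open>The pair of \<open>x\<close> and a nonempty list is the same tree as the triple of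
  \<open>x\<close>, head and tail. The program of the \<open>Cons\<close> branch can thus start
  directly, without taking the list apart.\<close>

lemma ptime_case_list:
  fixes f :: "'a::enc \<Rightarrow> 'b::enc list" and g :: "'a \<Rightarrow> 'c::enc"
  assumes f: "ptime f" and g: "ptime g"
    and h: "ptime (\<lambda>p. h (fst p) (fst (snd p)) (snd (snd p)))"
  shows "ptime (\<lambda>x. case f x of [] \<Rightarrow> g x | y # ys \<Rightarrow> h x y ys)"
proof -
  define G where "G = (\<lambda>p :: 'a \<times> 'b list. g (fst p))"
  define H where "H = (\<lambda>p. h (fst p) (fst (snd p)) (snd (snd p)))"
  define F where "F = (\<lambda>p :: 'a \<times> 'b list. case snd p of [] \<Rightarrow> g (fst p) | y # ys \<Rightarrow> h (fst p) y ys)"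
  have "ptime G" unfolding G_def by (intro ptime_comp[OF ptime_fst g] ptime_id)
  then obtain p k where p: "\<And>N. \<exists>c. computes c N G p" and k: "\<And>x. esize (G x) \<le> poly k (esize x)"
    by (rule ptimeE) blast
  obtain q l where q: "\<And>N. \<exists>c. computes c N H q" and l: "\<And>x. esize (H x) \<le> poly l (esize x)"
    using h unfolding H_def by (rule ptimeE) blast
  have F_Nil: "F (x, []) = G (x, [])" for x by (simp add: F_def G_def)
  have F_Cons: "F (x, y # ys) = H (x, y, ys)" for x y ys by (simp add: F_def H_def)
  have enc_eq: "enc (x, y # ys) = enc (x, y, ys)" for x :: 'a and y :: 'b and ys
    by (simp add: enc_prod_inst enc_list_inst)
  have "ptime F"
  proof (rule ptimeI[where p = "p + q + [:3:]" and q = "k + l"])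
    fix N
    obtain c d where c: "computes c N G p" and d: "computes d N H q" using p q by meson
    have "computes (If (RightE (Var N)) d c) N F (p + q + [:3:])"
    proof (rule computesI)
      fix z :: "'a \<times> 'b list" and s :: state
      assume s: "s N = enc z" "\<forall>i>N. s i = Leaf"
      obtain x ys where z: "z = (x, ys)" by (cases z)
      show "\<exists>t \<le> poly (p + q + [:3:]) (esize z). exec (If (RightE (Var N)) d c) s t (s(N := enc (F z)))"
      proof (cases ys)
        case Nil
        obtain t where t: "t \<le> poly p (esize z)" "exec c s t (s(N := enc (G z)))"
          using computesE[OF c, of s z] s by auto
        have "exec (If (RightE (Var N)) d c) s (1 + cost_exp (RightE (Var N)) + t) (s(N := enc (G z)))"
          by (rule exec.IfFalse[OF _ t(2)]) (simp add: s z Nil enc_prod_inst enc_list_inst)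
        then show ?thesis using t(1) F_Nil
          by (intro exI[of _ "1 + cost_exp (RightE (Var N)) + t"]) (simp add: z Nil)
      next
        case (Cons y zs)
        let ?w = "(x, y, zs)"
        obtain t where t: "t \<le> poly q (esize ?w)" "exec d s t (s(N := enc (H ?w)))"
          using computesE[OF d, of s ?w] s by (auto simp: z Cons enc_eq)
        have "exec (If (RightE (Var N)) d c) s (1 + cost_exp (RightE (Var N)) + t) (s(N := enc (H ?w)))"
          by (rule exec.IfTrue[OF _ t(2)]) (simp add: s z Cons enc_prod_inst enc_list_inst)
        then show ?thesis using t(1)
          by (intro exI[of _ "1 + cost_exp (RightE (Var N)) + t"]) (simp add: z Cons F_Cons enc_eq)
      qed
    qed
    then show "\<exists>c. computes c N F (p + q + [:3:])" ..
  next
    fix z :: "'a \<times> 'b list" show "esize (F z) \<le> poly (k + l) (esize z)"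
    proof (cases z)
      case (Pair x ys)
      then show ?thesis using k[of z] l[of "(x, hd ys, tl ys)"]
        by (cases ys) (auto simp: F_Nil F_Cons enc_eq)
    qed
  qed
  then have "ptime (\<lambda>x. F (x, f x))"
    by (rule ptime_comp[rotated]) (intro ptime_Pair ptime_id f)
  then show ?thesis unfolding F_def fst_conv snd_conv .
qed

section \<open>Boolean connectives and list functions\<close>

lemma ptime_null: "ptime f \<Longrightarrow> ptime (\<lambda>x. f x = [])"
proof -
  assume "ptime f"
  then have "ptime (\<lambda>x. case f x of [] \<Rightarrow> True | y # ys \<Rightarrow> False)"
    by (intro ptime_case_list ptime_const)
  then show ?thesis by (rule ptime_recode[rotated]) (auto split: list.split)
qed

lemma ptime_not: "ptime f \<Longrightarrow> ptime (\<lambda>x. \<not> f x)"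
proof -
  assume "ptime f"
  then have "ptime (\<lambda>x. if f x then False else True)" by (intro ptime_if ptime_const)
  then show ?thesis by (rule ptime_recode[rotated]) auto
qed

lemma ptime_conj: "ptime f \<Longrightarrow> ptime g \<Longrightarrow> ptime (\<lambda>x. f x \<and> g x)"
proof -
  assume "ptime f" "ptime g"
  then have "ptime (\<lambda>x. if f x then g x else False)" by (intro ptime_if ptime_const)
  then show ?thesis by (rule ptime_recode[rotated]) auto
qed

lemma ptime_disj: "ptime f \<Longrightarrow> ptime g \<Longrightarrow> ptime (\<lambda>x. f x \<or> g x)"
proof -
  assume "ptime f" "ptime g"
  then have "ptime (\<lambda>x. if f x then True else g x)" by (intro ptime_if ptime_const)
  then show ?thesis by (rule ptime_recode[rotated]) auto
qed

lemma ptime_eq_bool: "ptime f \<Longrightarrow> ptime g \<Longrightarrow> ptime (\<lambda>x. f x = (g x :: bool))"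
proof -
  assume "ptime f" "ptime g"
  then have "ptime (\<lambda>x. if f x then g x else \<not> g x)" by (intro ptime_if ptime_not)
  then show ?thesis by (rule ptime_recode[rotated]) auto
qed

lemma ptime_tl: "ptime f \<Longrightarrow> ptime (\<lambda>x. tl (f x))"
proof (erule ptime_comp, rule ptime_expI[where e = "\<lambda>N. RightE (Var N)" and k = 3 and q = "[:0,1:]"])
  fix N :: nat and x :: "'b list" and s :: state
  assume "s N = enc x"
  then show "eval_exp (RightE (Var N)) s = enc (tl x)"
    by (cases x) (auto simp: enc_list_inst)
next
  fix x :: "'b list"
  show "esize (tl x) \<le> poly [:0, 1:] (esize x)"
    by (cases x) (auto simp: enc_list_inst)
qed simp

lemmas ptime_basic = ptime_id ptime_fst ptime_snd ptime_Pair ptime_Cons ptime_tl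

lemma ptime_rev:
  assumes "ptime xs" shows "ptime (\<lambda>x. rev (xs x))"
proof -
  obtain k where k: "\<And>x. esize (xs x) \<le> poly k (esize x)" using assms by (rule ptimeE) blast
  have "ptime (\<lambda>x. fold (\<lambda>y acc. y # acc) (xs x) [])"
  proof (rule ptime_fold_additive[where r = "[:1:] + k"])
    fix x y and acc :: "'b list" assume "y \<in> set (xs x)"
    then show "esize (y # acc) \<le> esize acc + poly ([:1:] + k) (esize x)"
      using esize_member[of y "xs x"] k[of x] by (simp add: esize_Cons)
  qed (intro ptime_basic ptime_const assms)+
  then show ?thesis by (simp add: rev_conv_fold)
qed

lemma ptime_map:
  assumes f: "ptime (\<lambda>p. f (fst p) (snd p))" and xs: "ptime xs"
  shows "ptime (\<lambda>x. map (f x) (xs x))"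
proof -
  obtain k where k: "\<And>x. esize (xs x) \<le> poly k (esize x)" using xs by (rule ptimeE) blast
  obtain l where l: "\<And>p. esize (f (fst p) (snd p)) \<le> poly l (esize p)" using f by (rule ptimeE) blast
  have "ptime (\<lambda>x. fold (\<lambda>y acc. f x y # acc) (xs x) [])"
  proof (rule ptime_fold_additive[where r = "[:1:] + pcompose l ([:1, 1:] + k)"])
    fix x y acc assume "y \<in> set (xs x)"
    then have "esize (x, y) \<le> poly ([:1, 1:] + k) (esize x)"
      using esize_member[of y "xs x"] k[of x] by (simp add: esize_Pair)
    from poly_mono_nat[OF this, of l]
    have "esize (f x y) \<le> poly l (poly ([:1, 1:] + k) (esize x))"
      using l[of "(x, y)"] by (simp del: poly_add)
    then show "esize (f x y # acc) \<le> esize acc + poly ([:1:] + pcompose l ([:1, 1:] + k)) (esize x)"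
      by (simp add: esize_Cons poly_pcompose)
  next
    have "ptime (\<lambda>p. (fst p, fst (snd p)))" by (intro ptime_basic)
    from ptime_comp[OF this f]
    show "ptime (\<lambda>p. f (fst p) (fst (snd p)) # snd (snd p))"
      by (intro ptime_basic) simp
  qed (intro ptime_const xs)+
  then have "ptime (\<lambda>x. rev (fold (\<lambda>y acc. f x y # acc) (xs x) []))" by (rule ptime_rev)
  moreover have "fold (\<lambda>y acc. f x y # acc) ys zs = rev (map (f x) ys) @ zs" for x ys zs
    by (induction ys arbitrary: zs) auto
  ultimately show ?thesis by simp
qed

lemma ptime_filter:
  assumes f: "ptime (\<lambda>p. f (fst p) (snd p))" and xs: "ptime xs"
  shows "ptime (\<lambda>x. filter (f x) (xs x))"
proof -
  obtain k where k: "\<And>x. esize (xs x) \<le> poly k (esize x)" using xs by (rule ptimeE) blast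
  have "ptime (\<lambda>x. fold (\<lambda>y acc. if f x y then y # acc else acc) (xs x) [])"
  proof (rule ptime_fold_additive[where r = "[:1:] + k"])
    fix x y and acc :: "'b list" assume "y \<in> set (xs x)"
    then show "esize (if f x y then y # acc else acc) \<le> esize acc + poly ([:1:] + k) (esize x)"
      using esize_member[of y "xs x"] k[of x] by (simp add: esize_Cons)
  next
    have "ptime (\<lambda>p. (fst p, fst (snd p)))" by (intro ptime_basic)
    from ptime_comp[OF this f]
    show "ptime (\<lambda>p. if f (fst p) (fst (snd p)) then fst (snd p) # snd (snd p) else snd (snd p))"
      by (intro ptime_if ptime_basic) simp
  qed (intro ptime_const xs)+
  then have "ptime (\<lambda>x. rev (fold (\<lambda>y acc. if f x y then y # acc else acc) (xs x) []))"
    by (rule ptime_rev)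
  moreover have "fold (\<lambda>y acc. if f x y then y # acc else acc) ys zs = rev (filter (f x) ys) @ zs"
    for x ys zs
    by (induction ys arbitrary: zs) auto
  ultimately show ?thesis by simp
qed

lemma esize_append: "esize (xs @ ys) = esize xs + esize ys"
  by (induction xs) (auto simp: esize_Cons esize_Nil)

lemma ptime_append:
  assumes "ptime xs" and "ptime ys" shows "ptime (\<lambda>x. xs x @ ys x)"
proof -
  have rxs: "ptime (\<lambda>x. rev (xs x))" by (rule ptime_rev[OF assms(1)])
  obtain k where k: "\<And>x. esize (rev (xs x)) \<le> poly k (esize x)" using rxs by (rule ptimeE) blast
  have "ptime (\<lambda>x. fold (\<lambda>y acc. y # acc) (rev (xs x)) (ys x))"
  proof (rule ptime_fold_additive[where r = "[:1:] + k"])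
    fix x y and acc :: "'b list" assume "y \<in> set (rev (xs x))"
    then show "esize (y # acc) \<le> esize acc + poly ([:1:] + k) (esize x)"
      using esize_member[of y "rev (xs x)"] k[of x] by (simp add: esize_Cons)
  qed (intro ptime_basic rxs assms)+
  then show ?thesis by (simp add: fold_Cons_rev)
qed

lemma ptime_concat:
  assumes "ptime xs" shows "ptime (\<lambda>x. concat (xs x))"
proof -
  obtain k where k: "\<And>x. esize (xs x) \<le> poly k (esize x)" using assms by (rule ptimeE) blast
  have "ptime (\<lambda>x. fold (\<lambda>y acc. acc @ y) (xs x) [])"
  proof (rule ptime_fold_additive[where r = k])
    fix x y and acc :: "'b list" assume "y \<in> set (xs x)"
    then show "esize (acc @ y) \<le> esize acc + poly k (esize x)"
      using esize_member[of y "xs x"] k[of x] by (simp add: esize_append)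
  qed (intro ptime_basic ptime_append ptime_const assms)+
  moreover have "fold (\<lambda>y acc. acc @ y) ys zs = zs @ concat ys" for ys and zs :: "'b list"
    by (induction ys arbitrary: zs) auto
  ultimately show ?thesis by simp
qed

lemma esize_tl: "esize (tl xs) \<le> esize xs"
  by (cases xs) (auto simp: esize_Cons)

lemma esize_bool: "esize (b :: bool) \<le> 1"
  by (cases b) (auto simp: enc_bool_inst)

lemma ptime_drop_length:
  assumes "ptime xs" and "ptime ys" shows "ptime (\<lambda>x. drop (length (xs x)) (ys x))"
proof -
  have "ptime (\<lambda>x. fold (\<lambda>_ acc. tl acc) (xs x) (ys x))"
    by (rule ptime_fold_additive[where r = 0])
      (intro ptime_basic assms | use esize_tl in simp)+
  moreover have "fold (\<lambda>_ acc. tl acc) us zs = drop (length us) zs" for us :: "'b list" and zs :: "'c list"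
    by (induction us arbitrary: zs) (auto simp: drop_Suc)
  ultimately show ?thesis by simp
qed

lemma ptime_take_length:
  assumes k: "ptime k" and xs: "ptime xs" shows "ptime (\<lambda>x. take (length (k x)) (xs x))"
proof -
  obtain l where l: "\<And>x. esize (xs x) \<le> poly l (esize x)" using xs by (rule ptimeE) blast
  let ?f = "\<lambda>y st. case fst st of [] \<Rightarrow> st | _ # us \<Rightarrow> (us, y # snd st)"
  have "ptime (\<lambda>x. fold ?f (xs x) (k x, []))"
  proof (rule ptime_fold_additive[where r = "[:1:] + l"])
    fix x y and st :: "'b list \<times> 'c list" assume "y \<in> set (xs x)"
    then show "esize (?f y st) \<le> esize st + poly ([:1:] + l) (esize x)"
      using esize_member[of y "xs x"] l[of x]
      by (cases st) (auto simp: esize_Cons esize_Pair split: list.split)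
  qed (intro ptime_basic ptime_case_list ptime_const assms)+
  then have "ptime (\<lambda>x. rev (snd (fold ?f (xs x) (k x, []))))" by (intro ptime_rev ptime_snd)
  moreover have "snd (fold ?f ys (us, zs)) = rev (take (length us) ys) @ zs"
    for ys zs :: "'c list" and us :: "'b list"
    by (induction ys arbitrary: us zs) (auto split: list.split)
  ultimately show ?thesis by simp
qed

section \<open>Arithmetic on binary numbers\<close>

lemma ptime_bits: "ptime f \<Longrightarrow> ptime (\<lambda>x. bits (f x))"
  by (rule ptime_recode[rotated]) (auto simp: enc_nat_inst enc_list_inst enc_bool_inst enc_nat_def)

lemma bits_inj: "bits m = bits n \<Longrightarrow> m = n"
proof (induction m arbitrary: n rule: less_induct)
  case (less m)
  show ?case
  proof (cases "m = 0 \<or> n = 0")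
    case True
    then show ?thesis using less.prems by (subst (asm) (1 2) bits.simps) (auto split: if_splits)
  next
    case False
    then have "odd m = odd n" "bits (m div 2) = bits (n div 2)"
      using less.prems by (subst (asm) (1 2) bits.simps, simp)+
    moreover from this have "m div 2 = n div 2" using less.IH False by simp
    ultimately show ?thesis by (metis odd_two_times_div_two_succ dvd_mult_div_cancel)
  qed
qed

text \<open>Trees cannot be compared in one step, so the bits are compared one by one: one list
  drives the loop, the other is consumed along with it and must end up empty.\<close>

lemma ptime_eq_nat:
  fixes f g :: "'a::enc \<Rightarrow> nat"
  assumes f: "ptime f" and g: "ptime g" shows "ptime (\<lambda>x. f x = g x)"
proof -
  let ?f = "\<lambda>b st. (tl (fst st), snd st \<and> (case fst st of [] \<Rightarrow> False | c # _ \<Rightarrow> b = c))"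
  have "ptime (\<lambda>x. fold ?f (bits (f x)) (bits (g x), True))"
  proof (rule ptime_fold_additive[where r = "[:1:]"])
    fix x y and st :: "bool list \<times> bool"
    show "esize (?f y st) \<le> esize st + poly [:1:] (esize x)"
      using esize_tl[of "fst st"] esize_bool[of "snd (?f y st)"] by (cases st) (simp add: esize_Pair)
  qed (intro ptime_basic ptime_case_list ptime_const ptime_conj ptime_bits ptime_eq_bool assms)+
  then have *: "ptime (\<lambda>x. fst (fold ?f (bits (f x)) (bits (g x), True)) = [] \<and>
      snd (fold ?f (bits (f x)) (bits (g x), True)))"
    by (intro ptime_conj ptime_null ptime_fst ptime_snd)
  have eq: "fst (fold ?f xs (ys, ok)) = [] \<and> snd (fold ?f xs (ys, ok)) \<longleftrightarrow> xs = ys \<and> ok" for xs ys ok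
    by (induction xs arbitrary: ys ok) (auto simp: neq_Nil_conv split: list.splits)
  have "ptime (\<lambda>x. bits (f x) = bits (g x) \<and> True)" using * unfolding eq .
  moreover have "f x = g x \<longleftrightarrow> bits (f x) = bits (g x) \<and> True" for x using bits_inj by metis
  ultimately show ?thesis by simp
qed

text \<open>Binary increment: the state consists of the carry and the reversed output. The new bit
  is the exclusive or of carry and input bit, and \<open>finish\<close> appends a leftover
  carry.\<close>

lemma ptime_Suc:
  fixes f :: "'a::enc \<Rightarrow> nat"
  assumes f: "ptime f" shows "ptime (\<lambda>x. Suc (f x))"
proof -
  define step where "step = (\<lambda>b st. (fst st \<and> b, (\<not> fst st = b) # snd st))"
  define finish where "finish = (\<lambda>st :: bool \<times> bool list. if fst st then rev (True # snd st) else rev (snd st))"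
  have "ptime (\<lambda>x. fold step (bits (f x)) (True, []))"
  proof (rule ptime_fold_additive[where r = "[:3:]"])
    show "esize (step y st) \<le> esize st + poly [:3:] (esize x)" for x :: 'a and y st
      using esize_bool[of "fst st \<and> y"] esize_bool[of "\<not> fst st = y"]
      by (cases st) (simp add: esize_Pair esize_Cons step_def del: not_iff)
  qed ((unfold step_def)?, intro ptime_basic ptime_not ptime_const ptime_conj ptime_bits ptime_eq_bool assms)+
  then have "ptime (\<lambda>x. finish (fold step (bits (f x)) (True, [])))"
    unfolding finish_def by (intro ptime_if ptime_basic ptime_const ptime_rev)
  moreover have F: "fold step bs (False, out) = (False, rev bs @ out)" for bs out
    by (induction bs arbitrary: out) (auto simp: step_def)
  \<comment> \<open>While the carry is set, ones turn into zeros. The first zero absorbs the carry,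
    and by \<open>F\<close> the rest is copied.\<close>
  have "finish (fold step (bits n) (True, out)) = rev out @ bits (Suc n)" for n out
  proof (induction n arbitrary: out rule: less_induct)
    case (less n)
    show ?case
    proof (cases "n = 0")
      case True
      then show ?thesis by (simp add: bits.simps finish_def)
    next
      case False
      have b: "bits n = odd n # bits (n div 2)" using False by (subst bits.simps) simp
      show ?thesis
      proof (cases "odd n")
        case True
        then have "Suc n div 2 = Suc (n div 2)" by presburger
        then have "bits (Suc n) = False # bits (Suc (n div 2))"
          using True by (subst bits.simps) simp
        moreover have "n div 2 < n" using False by simp
        ultimately show ?thesis using less.IH[of "n div 2" "False # out"] True b
          by (simp add: fun_cong[OF fun_cong[OF step_def], of True])
      next
        case even: False
        then have "bits (Suc n) = True # bits (n div 2)"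
          by (subst bits.simps) auto
        then show ?thesis using even b F by (simp add: fun_cong[OF fun_cong[OF step_def], of False] finish_def)
      qed
    qed
  qed
  from this[of _ "[]"] have "bits (Suc n) = finish (fold step (bits n) (True, []))" for n by simp
  ultimately have "ptime (\<lambda>x. bits (Suc (f x)))" by simp
  then show ?thesis
    by (rule ptime_recode[rotated])
      (simp add: enc_nat_inst enc_list_inst enc_bool_inst enc_nat_def)
qed

lemma ptime_member:
  fixes f :: "'a::enc \<Rightarrow> nat"
  assumes "ptime f" and "ptime xs" shows "ptime (\<lambda>x. f x \<in> set (xs x))"
proof -
  have "ptime (\<lambda>x. filter (\<lambda>y. f x = y) (xs x) \<noteq> [])"
    by (intro ptime_not ptime_null ptime_filter ptime_eq_nat ptime_comp[OF ptime_fst assms(1)] ptime_basic assms)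
  moreover have "filter (\<lambda>y. f x = y) (xs x) \<noteq> [] \<longleftrightarrow> f x \<in> set (xs x)" for x
    by (auto simp: filter_empty_conv)
  ultimately show ?thesis by simp
qed

section \<open>The kernelization runs in polynomial time\<close>

lemmas ptime_intros = ptime_id ptime_const ptime_fst ptime_snd ptime_Pair ptime_Cons ptime_tl
  ptime_if ptime_case_list ptime_null ptime_not ptime_conj ptime_disj ptime_rev ptime_map
  ptime_filter ptime_append ptime_concat ptime_drop_length ptime_take_length ptime_eq_nat ptime_Suc
  ptime_member

lemma ptime_comp2:
  "ptime (\<lambda>p. h (fst p) (snd p)) \<Longrightarrow> ptime f \<Longrightarrow> ptime g \<Longrightarrow> ptime (\<lambda>x. h (f x) (g x))"
  using ptime_comp[of "\<lambda>x. (f x, g x)" "\<lambda>p. h (fst p) (snd p)"] by (simp add: ptime_Pair)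

text \<open>A crude bound compared with the logarithmic truth, but it suffices: it is applied to
  counters and indices that are bounded by lengths of lists.\<close>

lemma esize_nat_le: "esize (n :: nat) \<le> 2 * n"
proof -
  have "esize (bits n) \<le> 2 * n"
  proof (induction n rule: less_induct)
    case (less n)
    show ?case
    proof (cases "n = 0")
      case True
      then show ?thesis by (simp add: bits.simps esize_Nil)
    next
      case False
      then have "bits n = odd n # bits (n div 2)" by (subst bits.simps) simp
      moreover have "esize (bits (n div 2)) \<le> 2 * (n div 2)" using False by (intro less) simp
      ultimately show ?thesis using False esize_bool[of "odd n"] by (simp add: esize_Cons) presburger
    qed
  qed
  then show ?thesis by (simp add: enc_nat_inst enc_list_inst enc_bool_inst enc_nat_def)
qed

lemma esize_modify_le:
  assumes "\<And>x l. esize (F x l) \<le> esize l"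
  shows "esize (modify F W) \<le> esize W"
  unfolding modify_def using assms
  by (induction W) (auto simp: esize_Cons enc_prod_inst intro!: add_mono)

lemma esize_filter_le: "esize (filter Q xs) \<le> esize xs"
  by (induction xs) (auto simp: esize_Cons)

lemma esize_take_le: "esize (take n xs) \<le> esize xs"
  by (induction xs arbitrary: n) (auto simp: esize_Cons esize_Nil take_Cons split: nat.split)

lemma esize_clear_or_trim: "esize (clear_or_trim st) \<le> esize st"
proof -
  have "esize (trim W g) \<le> esize W" for W g
    unfolding trim_def
    by (rule esize_modify_le) (auto intro: order_trans[OF esize_filter_le] esize_take_le)
  moreover have "esize (clear x y W) \<le> esize W" for x y W
    unfolding clear_def by (rule esize_modify_le) (auto simp: esize_Nil)
  ultimately show ?thesis
    by (cases st) (auto simp: clear_or_trim_def esize_Pair split: list.split)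
qed

text \<open>Since a step never enlarges the state, iterating it stays within the initial size, and
  \<open>ptime_fold_additive\<close> applies with increment 0.\<close>

lemma esize_step: "esize (step st) \<le> esize st"
proof -
  have "esize (pop z W) \<le> esize W" for z W
    unfolding pop_def by (rule esize_modify_le) (auto simp: esize_tl)
  then have "esize (pop z W) \<le> Suc (esize W + k)" for z W k
    by (meson le_SucI trans_le_add1)
  then show ?thesis using esize_clear_or_trim[of st]
    by (cases st) (auto simp: step_def esize_Pair esize_Cons split: list.split)
qed

lemma ptime_lookup: "ptime (\<lambda>p. lookup (fst p) (snd p))"
  unfolding lookup_def
  by (rule ptime_fold_additive[where r = "[:0, 1:]"])
    (intro ptime_intros | auto simp: esize_Pair enc_prod_inst dest!: esize_member)+

lemma ptime_head_dead: "ptime (\<lambda>p. head_dead (fst p) (snd p))"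
  unfolding head_dead_def by (intro ptime_intros ptime_comp2[OF ptime_lookup])

lemma ptime_head_mutual: "ptime (\<lambda>p. head_mutual (fst p) (snd p))"
  unfolding head_mutual_def by (intro ptime_intros ptime_comp2[OF ptime_lookup])

lemma ptime_pop: "ptime (\<lambda>p. pop (fst p) (snd p))"
  unfolding pop_def modify_def by (intro ptime_intros)

lemma ptime_clear: "ptime (\<lambda>p. clear (fst p) (fst (snd p)) (snd (snd p)))"
  unfolding clear_def modify_def by (intro ptime_intros)

lemma ptime_nonempty: "ptime nonempty"
  unfolding nonempty_def by (intro ptime_intros)

lemmas ptime_nonempty' = ptime_comp[OF _ ptime_nonempty]

lemma ptime_half_drop:
  assumes "ptime xs" "ptime ys"
  shows "ptime (\<lambda>x. half_drop (xs x) (ys x))"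
  unfolding half_drop_def
proof (rule ptime_snd, rule ptime_fold_additive[where r = "[:1:]"])
  fix x y and st :: "bool \<times> 'c list"
  show "esize (\<not> fst st, if fst st then snd st else tl (snd st)) \<le> esize st + poly [:1:] (esize x)"
    using esize_bool[of "\<not> fst st"] esize_tl[of "snd st"] by (cases st) (auto simp: esize_Pair)
qed (intro ptime_intros assms)+

lemma ptime_trim: "ptime (\<lambda>p. trim (fst p) (snd p))"
  unfolding trim_def modify_def
  by (intro ptime_intros ptime_nonempty' ptime_half_drop ptime_comp2[OF ptime_lookup])

lemma ptime_clear_or_trim: "ptime clear_or_trim"
proof -
  have clear: "ptime (\<lambda>x. clear (f x) (g x) (h x))" if "ptime f" "ptime g" "ptime h"
    for f g h :: "'x::enc \<Rightarrow> _"
    using ptime_comp[OF ptime_Pair[OF that(1) ptime_Pair[OF that(2,3)]] ptime_clear] by simp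
  show ?thesis
    unfolding clear_or_trim_def
    by (intro ptime_intros ptime_nonempty' clear ptime_comp2[OF ptime_trim] ptime_comp2[OF ptime_head_mutual])
qed

lemma ptime_step: "ptime step"
  unfolding step_def
  by (intro ptime_intros ptime_comp[OF _ ptime_clear_or_trim] ptime_comp2[OF ptime_pop]
      ptime_comp2[OF ptime_head_dead])

lemma ptime_steps:
  assumes "ptime xs" "ptime st"
  shows "ptime (\<lambda>x. fold (\<lambda>_. step) (xs x) (st x))"
  by (rule ptime_fold_additive[where r = 0])
    (use esize_step in \<open>auto intro!: ptime_intros ptime_comp[OF _ ptime_step] assms\<close>)

lemma ptime_length:
  assumes xs: "ptime xs"
  shows "ptime (\<lambda>x. length (xs x))"
proof -
  obtain k where k: "\<And>x. esize (xs x) \<le> poly k (esize x)" using xs by (rule ptimeE) blast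
  have eq: "fold (\<lambda>_. Suc) ys n = length ys + n" for ys :: "'b list" and n
    by (induction ys arbitrary: n) auto
  have "ptime (\<lambda>x. fold (\<lambda>_. Suc) (xs x) 0)"
  proof (rule ptime_fold[where B = "smult 2 k"])
    fix x ys zs assume "xs x = ys @ zs"
    then have "length ys \<le> poly k (esize x)"
      using length_le_esize[of "xs x"] k[of x] by simp
    then show "esize (fold (\<lambda>_. Suc) ys 0) \<le> poly (smult 2 k) (esize x)"
      using esize_nat_le[of "length ys"] by (simp add: eq)
  qed (intro ptime_intros xs)+
  then show ?thesis by (simp add: eq)
qed

lemma esize_replicate_unit: "esize (replicate n ()) = n"
  by (induction n) (auto simp: esize_Cons esize_Nil enc_unit_def)

lemma ptime_cap: "ptime (\<lambda>I. cap (fst I) (snd I))"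
proof -
  let ?xs = "\<lambda>I :: esr_instance. concat (fst I)"
  have xs: "ptime ?xs" by (intro ptime_intros)
  obtain k where k: "\<And>I. esize (?xs I) \<le> poly k (esize I)" using xs by (rule ptimeE) blast
  show ?thesis
    unfolding cap_def
  \<comment> \<open>After \<open>n\<close> rounds the counter has size at most \<open>2 * n\<close>
    and the unary list at most \<open>n\<close>; 1 is for the pair node.\<close>
  proof (rule ptime_snd, rule ptime_fold[where B = "[:1:] + smult 3 k"])
    fix I :: esr_instance and ys zs assume "?xs I = ys @ zs"
    then have l: "length ys \<le> poly k (esize I)"
      using length_le_esize[of "?xs I"] k[of I] by simp
    show "esize (fold (\<lambda>_ st. if fst st = snd I then st else (Suc (fst st), () # snd st)) ys (0, []))
        \<le> poly ([:1:] + smult 3 k) (esize I)"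
      using fold_cap[of 0 "snd I" ys] esize_nat_le[of "min (snd I) (length ys)"] l
      by (simp add: esize_Pair esize_replicate_unit)
  qed (intro ptime_intros xs)+
qed

lemma esize_rev: "esize (rev xs) = esize xs"
  by (induction xs) (auto simp: esize_append esize_Cons esize_Nil)

lemma esize_zip_upt: "esize (zip [k..<k + length xs] xs) \<le> length xs * (2 + 2 * (k + length xs)) + esize xs"
proof (induction xs arbitrary: k)
  case (Cons x xs)
  have "[k..<k + length (x # xs)] = k # [Suc k..<Suc k + length xs]" by (subst upt_conv_Cons) auto
  then have "esize (zip [k..<k + length (x # xs)] (x # xs)) =
      2 + esize k + esize x + esize (zip [Suc k..<Suc k + length xs] xs)"
    by (simp add: esize_Cons esize_Pair)
  then show ?case using Cons[of "Suc k"] esize_nat_le[of k] by (simp add: esize_Cons)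
qed (simp add: esize_Nil)

lemma ptime_enum:
  assumes xs: "ptime xs"
  shows "ptime (\<lambda>x. enum (xs x))"
proof -
  obtain k where k: "\<And>x. esize (xs x) \<le> poly k (esize x)" using xs by (rule ptimeE) blast
  let ?f = "\<lambda>y st. (Suc (fst st), (fst st, y) # snd st)"
  have "ptime (\<lambda>x. fold ?f (xs x) (1, []))"
  \<comment> \<open>Quadratic, because every entry of the enumeration carries its own index and the
    size of an index is bounded linearly in the length.\<close>
  proof (rule ptime_fold[where B = "[:3:] + smult 2 k + k * ([:4:] + smult 2 k) + k"])
    fix x ys zs assume eq: "xs x = ys @ zs"
    let ?n = "poly k (esize x)"
    have len: "length ys \<le> ?n"
      using length_le_esize[of "xs x"] k[of x] eq by simp
    have "fold ?f ys (1, []) = (1 + length ys, rev (zip [1..<1 + length ys] ys))"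
      using fold_enum[of ys 1 "[]"] by simp
    then have "esize (fold ?f ys (1, [])) = 1 + esize (1 + length ys) + esize (zip [1..<1 + length ys] ys)"
      by (simp only: esize_Pair esize_rev)
    also have "\<dots> \<le> 1 + 2 * (1 + length ys) + (length ys * (4 + 2 * length ys) + esize ys)"
      using esize_zip_upt[of 1 ys] by (intro add_mono esize_nat_le) (simp_all add: algebra_simps del: upt_Suc)
    also have "\<dots> \<le> 1 + 2 * (1 + ?n) + (?n * (4 + 2 * ?n) + ?n)"
      using len k[of x] eq by (intro add_mono mult_mono) (auto simp: esize_append)
    finally have "esize (fold ?f ys (1, [])) \<le> 3 + 2 * ?n + ?n * (4 + 2 * ?n) + ?n" by simp
    then show "esize (fold ?f ys (1, [])) \<le>
        poly ([:3:] + smult 2 k + k * ([:4:] + smult 2 k) + k) (esize x)"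
      by simp
  qed (intro ptime_intros xs)+
  then show ?thesis unfolding enum_def by (intro ptime_rev ptime_snd)
qed

lemma ptime_number: "ptime (\<lambda>p. number (fst p) (snd p))"
proof -
  let ?T = "\<lambda>p :: table \<times> nat. enum (fst p)"
  have T: "ptime ?T" by (intro ptime_enum ptime_intros)
  obtain k where k: "\<And>p. esize (?T p) \<le> poly k (esize p)" using T by (rule ptimeE) blast
  show ?thesis
    unfolding number_def
  proof (rule ptime_fold_additive[where r = k])
    fix p e acc assume "e \<in> set (?T p)"
    then have "esize e \<le> poly k (esize p)" using esize_member[of e "?T p"] k[of p] by simp
    then show "esize (if fst (snd e) = snd p then fst e else acc) \<le> esize acc + poly k (esize p)"
      by (cases e) (auto simp: esize_Pair)
  qed (intro ptime_intros T)+
qed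

lemma ptime_dummies: "ptime (\<lambda>p. dummies (fst p) (snd p))"
  unfolding dummies_def by (intro ptime_intros ptime_enum)

text \<open>The accumulator holds the dummies not yet used and the output in reverse.\<close>

lemma ptime_place:
  fixes \<nu> :: "'a::enc \<Rightarrow> 'b::enc \<Rightarrow> 'c::enc"
  assumes P: "ptime (\<lambda>p. P (fst p) (snd p))" and \<nu>: "ptime (\<lambda>p. \<nu> (fst p) (snd p))"
    and l: "ptime l" and D: "ptime D"
  shows "ptime (\<lambda>x. place (P x) (\<nu> x) (l x) (D x))"
proof -
  obtain k where k: "\<And>x. esize (l x) \<le> poly k (esize x)" using l by (rule ptimeE) blast
  obtain b where b: "\<And>p. esize (\<nu> (fst p) (snd p)) \<le> poly b (esize p)" using \<nu> by (rule ptimeE) blast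
  let ?f = "\<lambda>x y st. if P x y then (fst st, \<nu> x y # snd st)
    else (case fst st of [] \<Rightarrow> st | d # D' \<Rightarrow> (D', d # snd st))"
  have "ptime (\<lambda>x. fold (?f x) (l x) (D x, []))"
  proof (rule ptime_fold_additive[where r = "[:1:] + pcompose b ([:1, 1:] + k)"])
    fix x y and st :: "'c list \<times> 'c list" assume "y \<in> set (l x)"
    then have "esize (x, y) \<le> poly ([:1, 1:] + k) (esize x)"
      using esize_member[of y "l x"] k[of x] by (simp add: esize_Pair)
    from poly_mono_nat[OF this, of b]
    have "esize (\<nu> x y) \<le> poly b (poly ([:1, 1:] + k) (esize x))"
      using b[of "(x, y)"] by (simp del: poly_add)
    then show "esize (?f x y st) \<le> esize st + poly ([:1:] + pcompose b ([:1, 1:] + k)) (esize x)"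
      by (cases st) (auto simp: esize_Cons esize_Pair poly_pcompose split: list.split)
  qed (intro ptime_intros ptime_comp2[OF P] ptime_comp2[OF \<nu>] l D)+
  then have "ptime (\<lambda>x. rev (snd (fold (?f x) (l x) (D x, []))))" by (intro ptime_intros)
  moreover have "snd (fold (?f x) ys (E, zs)) = rev (place (P x) (\<nu> x) ys E) @ zs" for x ys E zs
    by (induction ys arbitrary: E zs) (auto split: list.split)
  ultimately show ?thesis by simp
qed

lemma ptime_kernelize: "ptime kernelize"
  unfolding kernelize_def Let_def renumber_def
  by (intro ptime_intros ptime_nonempty' ptime_place ptime_length ptime_comp2[OF ptime_dummies]
      ptime_comp2[OF ptime_number] ptime_comp2[OF ptime_lookup])

lemma ptime_kernel: "ptime kernel"
  unfolding kernel_def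
  by (intro ptime_comp[OF _ ptime_kernelize] ptime_steps ptime_intros ptime_enum ptime_cap)

section \<open>The running time and the size of the kernel\<close>

lemma ptime_imp_poly_time_computable:
  fixes f :: "'a::enc \<Rightarrow> 'b::enc"
  assumes "ptime f"
  shows "poly_time_computable enc enc A f"
proof -
  obtain p where "\<And>N. \<exists>c. computes c N f p" using assms by (rule ptimeE) blast
  then obtain c where c: "computes c 0 f p" by blast
  show ?thesis
    unfolding poly_time_computable_def
  proof (intro exI[of _ c] exI[of _ p] ballI)
    fix x :: 'a
    obtain t where "t \<le> poly p (esize x)"
        "exec c ((\<lambda>_. Leaf)(0 := enc x)) t ((\<lambda>_. Leaf)(0 := enc (f x)))"
      using computesE[OF c, of "(\<lambda>_. Leaf)(0 := enc x)" x] by auto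
    then show "\<exists>t s. exec c ((\<lambda>_. Leaf)(0 := enc x)) t s \<and> s 0 = enc (f x) \<and> t \<le> poly p (esize x)"
      by (intro exI[of _ t] exI[of _ "(\<lambda>_. Leaf)(0 := enc (f x))"]) simp
  qed
qed

lemma enc_instance_eq: "enc_instance = enc"
  by (intro ext) (auto simp: enc_instance_def enc_prod_inst enc_list_inst enc_nat_inst)

lemma esr_size_le:
  assumes "length P \<le> max 2 (2 * g)" "\<And>i. i \<in> agents P \<Longrightarrow> length (pref_list P i) \<le> g + 1" "g' \<le> g"
  shows "esr_size (P, g') \<le> 2 * g\<^sup>2 + 7 * g + 4"
proof -
  have "length l \<le> g + 1" if l: "l \<in> set P" for l
  proof -
    obtain i where "i < length P" "l = P ! i" using l by (auto simp: in_set_conv_nth)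
    then show ?thesis using assms(2)[of "Suc i"] by (simp add: agents_def pref_list_def)
  qed
  then have "sum_list (map length P) \<le> sum_list (map (\<lambda>_. g + 1) P)" by (intro sum_list_mono)
  also have "\<dots> = length P * (g + 1)" by (simp add: sum_list_triv)
  \<comment> \<open>The sum \<open>2 + 2 * g\<close> dominates the maximum. Adding it once more for
    the agents, and \<open>g\<close> for the parameter, gives
    \<open>2 * g\<^sup>2 + 7 * g + 4\<close>.\<close>
  also have "\<dots> \<le> (2 + 2 * g) * (g + 1)" using assms(1) by (intro mult_right_mono) auto
  finally show ?thesis using assms(1,3)
    by (simp add: esr_size_def power2_eq_square algebra_simps max_def split: if_splits)
qed

theorem theorem6:
  shows "\<exists>f :: esr_instance \<Rightarrow> esr_instance.
    poly_time_computable enc_instance enc_instance esr_instances f \<and>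
    (\<exists>g :: nat \<Rightarrow> real. g \<in> O(\<lambda>\<gamma>. real \<gamma> ^ 2) \<and>
      (\<forall>P \<gamma> P' \<gamma>'. (P, \<gamma>) \<in> esr_instances \<longrightarrow> f (P, \<gamma>) = (P', \<gamma>') \<longrightarrow>
         (P', \<gamma>') \<in> esr_instances \<and>
         (esr_yes (P', \<gamma>') \<longleftrightarrow> esr_yes (P, \<gamma>)) \<and>
         real (esr_size (P', \<gamma>')) \<le> g \<gamma> \<and>
         (\<gamma> > 0 \<longrightarrow> card (agents P') \<le> 2 * \<gamma> + 1) \<and>
         (\<forall>i\<in>agents P'. length (pref_list P' i) \<le> \<gamma> + 1)))"
proof (intro exI[of _ kernel] exI[of _ "\<lambda>\<gamma>. real (2 * \<gamma>\<^sup>2 + 7 * \<gamma> + 4)"] conjI allI impI)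
  show "poly_time_computable enc_instance enc_instance esr_instances kernel"
    unfolding enc_instance_eq by (rule ptime_imp_poly_time_computable[OF ptime_kernel])
  show "(\<lambda>\<gamma>. real (2 * \<gamma>\<^sup>2 + 7 * \<gamma> + 4)) \<in> O(\<lambda>\<gamma>. real \<gamma> ^ 2)"
  \<comment> \<open>13 is the sum of the coefficients 2, 7 and 4, which suffices from
    \<open>\<gamma> = 1\<close> on.\<close>
  proof (rule bigoI[where c = 13], rule eventually_mono[OF eventually_ge_at_top[of 1]])
    fix \<gamma> :: nat assume "\<gamma> \<ge> 1"
    then have "\<gamma> \<le> \<gamma>\<^sup>2" "1 \<le> \<gamma>\<^sup>2" by (simp_all add: power2_eq_square)
    then have "2 * \<gamma>\<^sup>2 + 7 * \<gamma> + 4 \<le> 13 * \<gamma>\<^sup>2" by linarith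
    then have "real (2 * \<gamma>\<^sup>2 + 7 * \<gamma> + 4) \<le> real (13 * \<gamma>\<^sup>2)" by (rule of_nat_mono)
    then show "norm (real (2 * \<gamma>\<^sup>2 + 7 * \<gamma> + 4)) \<le> 13 * norm (real \<gamma> ^ 2)" by simp
  qed
  fix P \<gamma> P' \<gamma>'
  assume "(P, \<gamma>) \<in> esr_instances" and k: "kernel (P, \<gamma>) = (P', \<gamma>')"
  then have "wf_profile P" by (simp add: esr_instances_def)
  note correct = kernel_correct[OF this k]
  show "(P', \<gamma>') \<in> esr_instances" using correct(1) by (simp add: esr_instances_def)
  show "esr_yes (P', \<gamma>') \<longleftrightarrow> esr_yes (P, \<gamma>)" by (rule correct(2))
  show "real (esr_size (P', \<gamma>')) \<le> real (2 * \<gamma>\<^sup>2 + 7 * \<gamma> + 4)"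
    by (intro of_nat_mono esr_size_le correct)
  \<comment> \<open>For positive \<open>\<gamma>\<close> the two agents of the constant no-instance
    are also within \<open>2 * \<gamma>\<close>.\<close>
  show "card (agents P') \<le> 2 * \<gamma> + 1" if "\<gamma> > 0"
    using correct(4) that by (simp add: agents_def)
  show "\<forall>i\<in>agents P'. length (pref_list P' i) \<le> \<gamma> + 1" using correct(5) by blast
qed

end
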